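(* Let $G$ be a countable discrete amenable group. Then $s(G)=\underline{s}(G)=1-|G|^{-1}$.
   Context: $|G|^{-1}$ is interpreted as $0$ when $G$ is infinite. Sofic dimension of a countable discrete group $G$ with identity $e$ (the specialization to groups of the sofic dimension of a p.m.p. groupoid). Put $I_G=G\cup\{0\}\subseteq\mathbb{C}[G]$, with $g^*=g^{-1}$ for $g\in G$ and $0^*=0$. Let $\tau$ be the canonical trace: $\tau(e)=1$, $\tau(g)=0$ for $g\in G\setminus\{e\}$, $\tau(0)=0$. For $\Omega\subseteq I_G$ let $\Omega^*=\{s^*:s\in\Omega\}$, let $\Omega^k$ be the set of products $s_1\cdots s_k$ with $s_i\in\Omega$, and let $\Omega^{\le n}=\bigcup_{k=1}^n\Omega^k$. Let $I_d$ be the set of partial permutation matrices in $M_d=M_d(\mathbb{C})$ (partial isometries with all entries $0$ or $1$), $\mathrm{tr}$ the normalized trace on $M_d$, and $\|a\|_2=\mathrm{tr}(a^*a)^{1/2}$. For a finite $F\subseteq I_G$, $n,d\in\mathbb{N}$, $\delta>0$, $\mathrm{SA}(F,n,\delta,d)$ is the set of all linear maps $\varphi:\mathbb{C}[G]\to M_d$ such that (1) $\|\varphi(s_1\cdots s_k)-\varphi(s_1)\cdots\varphi(s_k)\|_2<\delta$ for all $k=1,\dots,n$ and $s_1,\dots,s_k\in F\cup F^*$, (2) $\varphi((F\cup F^* )^{\le n})\subseteq I_d$, (3) $|\mathrm{tr}(\varphi(s))-\tau(s)|<\delta$ for all $s\in(F\cup F^* )^{\le n}$. For a set $\mathcal{Y}$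 of maps, $|\mathcal{Y}|_E$ is the cardinality of the set of restrictions $\{\varphi|_E:\varphi\in\mathcal{Y}\}$. For finite $E,F\subseteq I_G$ set $s_E(F,n,\delta)=\limsup_{d\to\infty}\frac{1}{d\log d}\log|\mathrm{SA}(F,n,\delta,d)|_E$ (with $\log 0=-\infty$) and $s_E(F)=\inf_{n\in\mathbb{N}}\inf_{\delta>0}s_E(F,n,\delta)$. The sofic dimension is $s(G)=\sup_E\inf_F s_E(F)$, where $E$ and $F$ range over the finite subsets of $I_G$. The lower sofic dimension $\underline{s}(G)$ is defined in the same way with $\liminf_{d\to\infty}$ in place of $\limsup_{d\to\infty}$. *)

theory Defs
  imports
    "HOL-Library.Poly_Mapping"
    "HOL-Library.FuncSet"
    "HOL-Library.Countable"
    "HOL-Library.Extended_Real"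
    "HOL-Library.Liminf_Limsup"
    "Jordan_Normal_Form.Schur_Decomposition"
begin

text \<open>
  A group is given by a type of class \<open>group_add\<close>. This class is written additively but does not
  assume commutativity: \<open>g + h\<close> is the group product, \<open>0\<close> the identity \<open>e\<close>, and \<open>- g\<close> the inverse.
  The complex group algebra is the type \<open>'g \<Rightarrow>\<^sub>0 complex\<close> of finitely supported functions, whose
  ring multiplication in the library is convolution; the group element \<open>g\<close> is
  \<open>Poly_Mapping.single g 1\<close>, and \<open>0 :: 'g \<Rightarrow>\<^sub>0 complex\<close> is the zero of the algebra.
  If the group is infinite then \<open>card UNIV = 0\<close>, so \<open>inverse (card UNIV) = 0\<close>.
\<close>

type_synonym 'g group_algebra = "'g \<Rightarrow>\<^sub>0 complex"

abbreviation grp_elem :: "'g \<Rightarrow> 'g group_algebra" where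
  "grp_elem g \<equiv> Poly_Mapping.single g 1"

text \<open>Existence of a finitely additive left-invariant probability measure on all subsets.\<close>

definition amenable :: "'g::group_add itself \<Rightarrow> bool" where
  "amenable _ \<longleftrightarrow>
     (\<exists>\<mu> :: 'g set \<Rightarrow> real.
        (\<forall>A. 0 \<le> \<mu> A) \<and> \<mu> UNIV = 1 \<and>
        (\<forall>A B. A \<inter> B = {} \<longrightarrow> \<mu> (A \<union> B) = \<mu> A + \<mu> B) \<and>
        (\<forall>g A. \<mu> ((+) g ` A) = \<mu> A))"


section \<open>The group algebra\<close>

text \<open>The involution of the group algebra, \<open>x\<^sup>*(g) = cnj (x(g\<^sup>-\<^sup>1))\<close>.\<close>

definition ga_star :: "'g::group_add group_algebra \<Rightarrow> 'g group_algebra" where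
  "ga_star x = Poly_Mapping.map cnj (Poly_Mapping.map_key uminus x)"

definition ga_trace :: "'g::group_add group_algebra \<Rightarrow> complex" where
  "ga_trace x = Poly_Mapping.lookup x 0"

lemma ga_star_grp_elem: "ga_star (grp_elem g) = grp_elem (- g :: 'g::group_add)"
proof -
  have "Poly_Mapping.map_key uminus (grp_elem (- (- g))) = grp_elem (- g)"
    by (rule map_key_single) simp
  then show ?thesis
    by (simp add: ga_star_def map_single)
qed

lemma ga_star_zero: "ga_star (0 :: 'g::group_add group_algebra) = 0"
  by (simp add: ga_star_def map_key_zero poly_mapping_eqI Poly_Mapping.map.rep_eq)

lemma ga_trace_grp_elem: "ga_trace (grp_elem (g :: 'g::group_add)) = (if g = 0 then 1 else 0)"
  by (auto simp: ga_trace_def lookup_single)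

lemma ga_trace_zero: "ga_trace (0 :: 'g::group_add group_algebra) = 0"
  by (simp add: ga_trace_def)

lemma grp_elem_mult: "grp_elem g * grp_elem h = grp_elem (g + h :: 'g::group_add)"
  by (simp add: mult_single)

definition I_G :: "'g::group_add group_algebra set" where
  "I_G = insert 0 (range grp_elem)"

definition products :: "'g::group_add group_algebra set \<Rightarrow> nat \<Rightarrow> 'g group_algebra set" where
  "products \<Omega> k = {prod_list ss | ss. length ss = k \<and> set ss \<subseteq> \<Omega>}"

definition products_upto :: "'g::group_add group_algebra set \<Rightarrow> nat \<Rightarrow> 'g group_algebra set" where
  "products_upto \<Omega> n = (\<Union>k\<in>{1..n}. products \<Omega> k)"


section \<open>Matrices\<close>

definition mtrace :: "complex mat \<Rightarrow> complex" where
  "mtrace A = (\<Sum>i<dim_row A. A $$ (i, i))"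

definition ntr :: "complex mat \<Rightarrow> complex" where
  "ntr A = mtrace A / of_nat (dim_row A)"

text \<open>\<open>ntr (a\<^sup>* a)\<close> is a nonnegative real number.\<close>

definition norm2 :: "complex mat \<Rightarrow> real" where
  "norm2 A = sqrt (Re (ntr (mat_adjoint A * A)))"

text \<open>\<open>v\<close> is a partial isometry if \<open>v\<^sup>* v\<close> is an orthogonal projection.\<close>

definition projection_mat :: "complex mat \<Rightarrow> bool" where
  "projection_mat P \<longleftrightarrow> mat_adjoint P = P \<and> P * P = P"

definition partial_isometry_mat :: "complex mat \<Rightarrow> bool" where
  "partial_isometry_mat V \<longleftrightarrow> projection_mat (mat_adjoint V * V)"

definition partial_perm_mats :: "nat \<Rightarrow> complex mat set" where
  "partial_perm_mats d =
     {V \<in> carrier_mat d d. partial_isometry_mat V \<and> (\<forall>i<d. \<forall>j<d. V $$ (i, j) \<in> {0, 1})}"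

definition linear_to_mat :: "nat \<Rightarrow> ('g group_algebra \<Rightarrow> complex mat) \<Rightarrow> bool" where
  "linear_to_mat d \<phi> \<longleftrightarrow>
     (\<forall>x. \<phi> x \<in> carrier_mat d d) \<and>
     (\<forall>x y. \<phi> (x + y) = \<phi> x + \<phi> y) \<and>
     (\<forall>c x. \<phi> (Poly_Mapping.map ((*) c) x) = c \<cdot>\<^sub>m \<phi> x)"


section \<open>Sofic dimension\<close>

definition SA :: "'g::group_add group_algebra set \<Rightarrow> nat \<Rightarrow> real \<Rightarrow> nat
    \<Rightarrow> ('g group_algebra \<Rightarrow> complex mat) set" where
  "SA F n \<delta> d =
     {\<phi>. linear_to_mat d \<phi> \<and>
        (\<forall>ss. 1 \<le> length ss \<and> length ss \<le> n \<and> set ss \<subseteq> F \<union> ga_star ` F \<longrightarrow>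
           norm2 (\<phi> (prod_list ss) - foldr (*) (map \<phi> ss) (1\<^sub>m d)) < \<delta>) \<and>
        \<phi> ` products_upto (F \<union> ga_star ` F) n \<subseteq> partial_perm_mats d \<and>
        (\<forall>s \<in> products_upto (F \<union> ga_star ` F) n. cmod (ntr (\<phi> s) - ga_trace s) < \<delta>)}"

text \<open>
  Logarithm of the cardinality of a set. The infinite case has to be separated, since \<open>card\<close> is \<open>0\<close>
  there: for \<open>E\<close> not contained in \<open>(F \<union> F\<^sup>*)\<^sup>\<le>\<^sup>n\<close> there can be infinitely many restrictions to \<open>E\<close>.
\<close>

definition log_card :: "'a set \<Rightarrow> ereal" where
  "log_card A = (if infinite A then \<infinity> else if A = {} then -\<infinity> else ereal (ln (real (card A))))"

text \<open>The values at \<open>d = 0\<close> and \<open>d = 1\<close>, where \<open>d log d = 0\<close>, do not affect limits in \<open>d\<close>.\<close>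

definition sofic_rate :: "'g::group_add group_algebra set \<Rightarrow> 'g group_algebra set
    \<Rightarrow> nat \<Rightarrow> real \<Rightarrow> nat \<Rightarrow> ereal" where
  "sofic_rate E F n \<delta> d =
     log_card ((\<lambda>\<phi>. restrict \<phi> E) ` SA F n \<delta> d) / ereal (real d * ln (real d))"

definition s_rel :: "'g::group_add group_algebra set \<Rightarrow> 'g group_algebra set \<Rightarrow> ereal" where
  "s_rel E F = (INF n\<in>{1..}. INF \<delta>\<in>{0<..}. limsup (sofic_rate E F n \<delta>))"

definition lower_s_rel :: "'g::group_add group_algebra set \<Rightarrow> 'g group_algebra set \<Rightarrow> ereal" where
  "lower_s_rel E F = (INF n\<in>{1..}. INF \<delta>\<in>{0<..}. liminf (sofic_rate E F n \<delta>))"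

definition sofic_dim :: "'g::group_add itself \<Rightarrow> ereal" where
  "sofic_dim _ =
     (SUP E\<in>{E. finite E \<and> E \<subseteq> (I_G :: 'g group_algebra set)}.
        INF F\<in>{F. finite F \<and> F \<subseteq> I_G}. s_rel E F)"

definition lower_sofic_dim :: "'g::group_add itself \<Rightarrow> ereal" where
  "lower_sofic_dim _ =
     (SUP E\<in>{E. finite E \<and> E \<subseteq> (I_G :: 'g group_algebra set)}.
        INF F\<in>{F. finite F \<and> F \<subseteq> I_G}. lower_s_rel E F)"

end

theory Submission
  imports Defs "HOL-Combinatorics.Permutations" "HOL-Real_Asymp.Real_Asymp"
begin

text \<open>
  Everything rests on the Folner condition: an amenable group contains, for all finite \<open>T\<close> and
  \<open>\<epsilon> > 0\<close>, a finite set \<open>K\<close> such that each \<open>t \<in> T\<close> moves at most \<open>\<epsilon> * card K\<close> points of \<open>K\<close> out of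
  \<open>K\<close> (\<open>amenable_almost_invariant\<close>). If it failed, some finite \<open>S\<close> would double the size of every
  finite set, Hall's theorem would give an injection \<open>G \<times> {0, 1} \<rightarrow> G\<close> that moves points only by
  elements of \<open>S\<close>, and two copies of \<open>G\<close>, cut into finitely many pieces and translated, would fit
  disjointly into \<open>G\<close>, which an invariant mean forbids.

  Lower bound (\<open>amenable_liminf_sofic_rate\<close>). Cut the regular representation down to a Folner set
  \<open>K\<close> and put as many copies of it as fit on \<open>d\<close> points. This is a sofic approximation, and so are
  its conjugates by the \<open>d!\<close> permutations of the points. Restrict them to a finite \<open>E \<subseteq> G\<close>. A
  permutation can be read off from the restricted conjugate and its values on a set of
  roots from which all points are reached by moves in \<open>E\<close>; about \<open>d / card E\<close> roots suffice. So
  there are at least about \<open>d! / d powr (d / card E)\<close> different restrictions, and the rate is at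
  least \<open>1 - 1 / card E\<close>. For \<open>E\<close> one takes the whole group if it is finite and arbitrarily large
  sets otherwise.

  Upper bound (\<open>amenable_s_rel_le\<close>). A good sofic approximation behaves on most of the \<open>d\<close> points
  like a free action. Order the points at random and let \<open>c x\<close> be the least point of
  \<open>{- k \<cdot> x | k \<in> K}\<close>, say \<open>c x = - \<kappa> x \<cdot> x\<close>. If \<open>y = s \<cdot> x\<close> has \<open>c y = c x\<close>, then freeness forces
  \<open>\<kappa> y = s + \<kappa> x\<close>, and \<open>y\<close> is the only point with these values of \<open>c\<close> and \<open>\<kappa>\<close>. So the approximation
  on \<open>E\<close> is determined by \<open>c\<close>, by \<open>\<kappa>\<close>, and by the value of \<open>s \<cdot> x\<close> at the pairs with
  \<open>c (s \<cdot> x) \<noteq> c x\<close>. Only values in \<open>{0..<d}\<close> count at the scale \<open>d * ln d\<close>: a bounded number of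
  choices per point contributes \<open>O(d)\<close> to the logarithm. Each point has \<open>c x = x\<close> with probability
  \<open>1 / card K\<close>, and nothing need be stored for it. The event \<open>c (s \<cdot> x) \<noteq> c x\<close> requires the least
  element of the union of the two candidate sets to lie outside their intersection, which has
  probability at most \<open>2 * \<epsilon>\<close> because \<open>K\<close> is almost invariant. (This is the min-wise hashing estimate
  for the Jaccard similarity; it replaces a quasi-tiling.) So some order makes do with
  \<open>d * (1 - 1 / card K)\<close> values up to a small multiple of \<open>d\<close>, and \<open>card K\<close> is at most the order
  of the group.
\<close>

section \<open>Hall's theorem for infinite families of finite sets\<close>

definition hall_condition :: "('i \<Rightarrow> 'a set) \<Rightarrow> bool" where
  "hall_condition A \<longleftrightarrow> (\<forall>I. finite I \<longrightarrow> card I \<le> card (\<Union>i\<in>I. A i))"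

text \<open>
  By Zorn's lemma a family with Hall's condition can be shrunk until no smaller family has it:
  the intersection of a chain still has it, because every finite subfamily of finite sets is
  constant from some member of the chain on.
\<close>

lemma hall_condition_minimal:
  fixes A :: "'i \<Rightarrow> 'a set"
  assumes fin: "\<And>i. finite (A i)" and hall: "hall_condition A"
  obtains B where "B \<le> A" "hall_condition B"
    "\<And>B'. B' \<le> B \<Longrightarrow> hall_condition B' \<Longrightarrow> B' = B"
proof -
  define \<F> where "\<F> = {B. B \<le> A \<and> hall_condition B}"
  let ?r = "relation_of (\<lambda>B B'. B' \<le> B) \<F>"
  have "\<exists>m\<in>\<F>. \<forall>a\<in>\<F>. a \<le> m \<longrightarrow> a = m"
  proof (rule predicate_Zorn)
    show "partial_order_on \<F> ?r"
      unfolding partial_order_on_def preorder_on_def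
      by (auto simp: refl_on_def trans_def antisym_def relation_of_def)
    fix C assume C: "C \<in> Chains ?r"
    show "\<exists>u\<in>\<F>. \<forall>a\<in>C. u \<le> a"
    proof (cases "C = {}")
      case True
      then show ?thesis using hall by (auto simp: \<F>_def)
    next
      case False
      have CF: "C \<subseteq> \<F>" and total: "\<And>B B'. B \<in> C \<Longrightarrow> B' \<in> C \<Longrightarrow> B \<le> B' \<or> B' \<le> B"
        using C by (auto simp: Chains_def relation_of_def)
      define u where "u i = (\<Inter>B\<in>C. B i)" for i
      have uB: "u \<le> B" if "B \<in> C" for B
        using that by (auto simp: u_def le_fun_def)
      have "hall_condition u"
        unfolding hall_condition_def
      proof (intro allI impI)
        fix I :: "'i set" assume I: "finite I"
        \<comment> \<open>On a finite index set the members of the chain stabilise, since the sets are finite.\<close>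
        obtain B where B: "B \<in> C" and
          least: "\<And>B'. B' \<in> C \<Longrightarrow> (\<Sum>i\<in>I. card (B i)) \<le> (\<Sum>i\<in>I. card (B' i))"
          using False ex_has_least_nat[of "\<lambda>B. B \<in> C" _ "\<lambda>B. \<Sum>i\<in>I. card (B i)"] by blast
        have "B i \<subseteq> B' i" if B': "B' \<in> C" and i: "i \<in> I" for B' i
        proof (cases "B \<le> B'")
          case True
          then show ?thesis by (auto simp: le_fun_def)
        next
          case False
          then have le: "B' \<le> B" using total B B' by blast
          have finB: "finite (B i)" for i
          proof (rule finite_subset[OF _ fin])
            show "B i \<subseteq> A i" using B CF by (auto simp: \<F>_def le_fun_def)
          qed
          have "B' i = B i"
          proof (rule ccontr)
            assume ne: "B' i \<noteq> B i"
            have "card (B' j) \<le> card (B j)" for j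
              using le finB by (auto simp: le_fun_def intro: card_mono)
            moreover have "card (B' i) < card (B i)"
              using le ne by (intro psubset_card_mono finB) (auto simp: le_fun_def)
            ultimately have "(\<Sum>i\<in>I. card (B' i)) < (\<Sum>i\<in>I. card (B i))"
              using I i by (intro sum_strict_mono_ex1) auto
            then show False using least[OF B'] by simp
          qed
          then show ?thesis by simp
        qed
        then have "u i = B i" if "i \<in> I" for i
          using B that unfolding u_def by blast
        then have "(\<Union>i\<in>I. u i) = (\<Union>i\<in>I. B i)"
          by (intro SUP_cong) auto
        moreover have "hall_condition B" using B CF by (auto simp: \<F>_def)
        ultimately show "card I \<le> card (\<Union>i\<in>I. u i)"
          using I by (simp add: hall_condition_def)
      qed
      moreover have "u \<le> A"
      proof -
        obtain B where "B \<in> C" using False by blast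
        then have "u \<le> B" "B \<le> A" using uB CF by (auto simp: \<F>_def)
        then show ?thesis by (rule order_trans)
      qed
      ultimately show ?thesis using uB by (auto simp: \<F>_def)
    qed
  qed
  then show thesis using that by (auto simp: \<F>_def dest: order_trans)
qed

text \<open>
  Rado's argument: if a set \<open>B i\<close> of a minimal family had two points \<open>x\<close> and \<open>y\<close>, removing either
  would violate Hall's condition at \<open>J \<union> {i}\<close> and \<open>L \<union> {i}\<close>. The two violations add up, via
  \<open>card P + card Q = card (P \<union> Q) + card (P \<inter> Q)\<close>, to a contradiction with Hall's condition at
  \<open>J \<union> L \<union> {i}\<close> and \<open>J \<inter> L\<close>.
\<close>

lemma hall_condition_minimal_singleton:
  fixes B :: "'i \<Rightarrow> 'a set"
  assumes fin: "\<And>i. finite (B i)" and hall: "hall_condition B"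
    and minimal: "\<And>B'. B' \<le> B \<Longrightarrow> hall_condition B' \<Longrightarrow> B' = B"
    and x: "x \<in> B i" and y: "y \<in> B i"
  shows "x = y"
proof (rule ccontr)
  assume "x \<noteq> y"
  have violated: "\<exists>J. finite J \<and> i \<notin> J \<and> card ((\<Union>j\<in>J. B j) \<union> (B i - {z})) \<le> card J"
    if z: "z \<in> B i" for z
  proof -
    define B' where "B' = B(i := B i - {z})"
    have "B' \<le> B" "B' \<noteq> B" using z by (auto simp: B'_def le_fun_def fun_eq_iff)
    then have "\<not> hall_condition B'" using minimal by blast
    then obtain I where I: "finite I" "card (\<Union>j\<in>I. B' j) < card I"
      by (auto simp: hall_condition_def not_le)
    have "i \<in> I"
    proof (rule ccontr)
      assume "i \<notin> I"
      then have "(\<Union>j\<in>I. B' j) = (\<Union>j\<in>I. B j)" by (auto simp: B'_def)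
      then show False using hall I by (metis hall_condition_def not_le)
    qed
    moreover from this have "(\<Union>j\<in>I. B' j) = (\<Union>j\<in>I - {i}. B j) \<union> (B i - {z})"
      by (auto simp: B'_def split: if_splits)
    ultimately show ?thesis using I
      by (intro exI[of _ "I - {i}"]) auto
  qed
  obtain J where J: "finite J" "i \<notin> J" "card ((\<Union>j\<in>J. B j) \<union> (B i - {x})) \<le> card J"
    using violated[OF x] by blast
  obtain L where L: "finite L" "i \<notin> L" "card ((\<Union>j\<in>L. B j) \<union> (B i - {y})) \<le> card L"
    using violated[OF y] by blast
  let ?P = "(\<Union>j\<in>J. B j) \<union> (B i - {x})" and ?Q = "(\<Union>j\<in>L. B j) \<union> (B i - {y})"
  have finPQ: "finite ?P" "finite ?Q" using fin J L by auto
  have "card J + card L + 1 = card (insert i (J \<union> L)) + card (J \<inter> L)"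
    using J L by (simp add: card_Un_Int[of J L])
  also have "\<dots> \<le> card (\<Union>j\<in>insert i (J \<union> L). B j) + card (\<Union>j\<in>J \<inter> L. B j)"
    using hall J L unfolding hall_condition_def by (intro add_mono) (metis finite_UnI finite_insert, blast)
  also have "\<dots> \<le> card (?P \<union> ?Q) + card (?P \<inter> ?Q)"
    using \<open>x \<noteq> y\<close> finPQ by (intro add_mono card_mono) auto
  also have "\<dots> = card ?P + card ?Q"
    using card_Un_Int[OF finPQ] by simp
  also have "\<dots> \<le> card J + card L" using J L by simp
  finally show False by simp
qed

theorem hall_infinite:
  fixes A :: "'i \<Rightarrow> 'a set"
  assumes fin: "\<And>i. finite (A i)"
    and hall: "\<And>I. finite I \<Longrightarrow> card I \<le> card (\<Union>i\<in>I. A i)"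
  obtains f where "inj f" "\<And>i. f i \<in> A i"
proof -
  obtain B where B: "B \<le> A" "hall_condition B"
    and minimal: "\<And>B'. B' \<le> B \<Longrightarrow> hall_condition B' \<Longrightarrow> B' = B"
    using hall_condition_minimal[of A] fin hall by (auto simp: hall_condition_def)
  have finB: "finite (B i)" for i
    using B fin by (auto simp: le_fun_def intro: finite_subset)
  have "card {i} \<le> card (\<Union>j\<in>{i}. B j)" for i
    using B unfolding hall_condition_def by blast
  then have "\<exists>x. x \<in> B i" for i
    by (metis card.empty card_1_singleton_iff UN_insert UN_empty sup_bot_right ex_in_conv
        is_singletonI is_singleton_altdef not_one_le_zero)
  then obtain f where f: "\<And>i. f i \<in> B i" by metis
  have single: "B i = {f i}" for i
    using hall_condition_minimal_singleton[OF finB B(2) minimal] f by blast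
  have "inj f"
  proof (rule injI, rule ccontr)
    fix i j assume eq: "f i = f j" and "i \<noteq> j"
    then have "card {i, j} = 2" by simp
    moreover have "(\<Union>k\<in>{i, j}. B k) = {f i}" using single eq by auto
    ultimately show False
      using B(2) unfolding hall_condition_def
      by (metis card_1_singleton_iff finite.emptyI finite.insertI numeral_le_one_iff
          One_nat_def semiring_norm(69))
  qed
  moreover have "f i \<in> A i" for i using f B by (auto simp: le_fun_def)
  ultimately show thesis by (rule that)
qed

section \<open>Amenability and the Folner condition\<close>

lemma measure_finite_UN:
  fixes \<mu> :: "'g set \<Rightarrow> real"
  assumes add: "\<forall>A B. A \<inter> B = {} \<longrightarrow> \<mu> (A \<union> B) = \<mu> A + \<mu> B"
    and I: "finite I" and disj: "disjoint_family_on A I"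
  shows "\<mu> (\<Union>i\<in>I. A i) = (\<Sum>i\<in>I. \<mu> (A i))"
  using I disj
proof (induction I rule: finite_induct)
  case empty
  show ?case using add[rule_format, of "{}" "{}"] by simp
next
  case (insert i I)
  have "A i \<inter> A j = {}" if "j \<in> I" for j
  proof (rule disjoint_family_onD[OF insert.prems])
    show "i \<noteq> j" using insert.hyps(2) that by metis
  qed (use that in simp_all)
  then have "A i \<inter> (\<Union>j\<in>I. A j) = {}" by blast
  from add[rule_format, OF this] have "\<mu> (\<Union>j\<in>insert i I. A j) = \<mu> (A i) + \<mu> (\<Union>j\<in>I. A j)"
    by (simp only: UN_insert)
  moreover have "disjoint_family_on A I"
    by (rule disjoint_family_on_mono[OF _ insert.prems]) blast
  then have "\<mu> (\<Union>j\<in>I. A j) = (\<Sum>j\<in>I. \<mu> (A j))" by (rule insert.IH)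
  ultimately show ?case by (simp only: sum.insert[OF insert.hyps])
qed

text \<open>
  Otherwise Hall's condition holds for the sets \<open>S + g\<close>, each used twice, so there is an injection
  \<open>\<psi>\<close> on \<open>G \<times> bool\<close> with \<open>\<psi> (g, b) \<in> S + g\<close>. For each \<open>b\<close> the pieces
  \<open>P (s, b) = {g. \<psi> (g, b) = s + g}\<close> partition \<open>G\<close>, while all translates \<open>s + P (s, b)\<close> are disjoint
  by injectivity: their total mean is \<open>2\<close>.
\<close>

lemma amenable_no_doubling:
  fixes S :: "'g::group_add set"
  assumes am: "amenable TYPE('g)" and S: "finite S"
  shows "\<exists>K::'g set. finite K \<and> card (\<Union>s\<in>S. (+) s ` K) < 2 * card K"
proof (rule ccontr)
  assume contra: "\<not> ?thesis"
  have doubling: "2 * card K \<le> card (\<Union>s\<in>S. (+) s ` K)" if "finite K" for K :: "'g set"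
    by (rule ccontr) (use contra that in \<open>auto simp: not_le\<close>)
  obtain \<mu> :: "'g set \<Rightarrow> real" where pos: "\<And>A. 0 \<le> \<mu> A" and one: "\<mu> UNIV = 1"
    and add: "\<forall>A B. A \<inter> B = {} \<longrightarrow> \<mu> (A \<union> B) = \<mu> A + \<mu> B"
    and inv: "\<And>g A. \<mu> ((+) g ` A) = \<mu> A"
    using am unfolding amenable_def by blast
  define N where "N = (\<lambda>(g, b::bool). (\<lambda>s. s + g) ` S)"
  obtain \<psi> where inj: "inj \<psi>" and \<psi>: "\<And>p. \<psi> p \<in> N p"
  proof (rule hall_infinite[of N])
    show "finite (N p)" for p using S by (simp add: N_def split: prod.split)
    fix I :: "('g \<times> bool) set" assume I: "finite I"
    have "card I \<le> card (fst ` I \<times> (UNIV :: bool set))"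
      using I by (intro card_mono) (auto, force)
    also have "\<dots> = 2 * card (fst ` I)" by (simp add: card_cartesian_product)
    also have "\<dots> \<le> card (\<Union>s\<in>S. (+) s ` fst ` I)" using doubling I by simp
    also have "(\<Union>s\<in>S. (+) s ` fst ` I) = (\<Union>p\<in>I. N p)"
      by (force simp: N_def)
    finally show "card I \<le> card (\<Union>p\<in>I. N p)" .
  qed blast
  define P where "P = (\<lambda>(s, b). {g. \<psi> (g, b) = s + g})"
  define J where "J = S \<times> (UNIV :: bool set)"
  have J: "finite J" using S by (simp add: J_def)
  have pieces: "(\<Sum>s\<in>S. \<mu> (P (s, b))) = 1" for b
  proof -
    have "(\<Union>s\<in>S. P (s, b)) = UNIV"
      using \<psi>[of "(_, b)"] by (fastforce simp: P_def N_def)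
    moreover have "disjoint_family_on (\<lambda>s. P (s, b)) S"
      by (auto simp: disjoint_family_on_def P_def)
    ultimately show ?thesis
      using measure_finite_UN[OF add S, of "\<lambda>s. P (s, b)"] one by simp
  qed
  have "disjoint_family_on (\<lambda>j. (+) (fst j) ` P j) J"
  proof -
    have "p = q" if zp: "z \<in> (+) (fst p) ` P p" and zq: "z \<in> (+) (fst q) ` P q" for p q z
    proof -
      obtain g where g: "z = fst p + g" "g \<in> P p" using zp by blast
      obtain h where h: "z = fst q + h" "h \<in> P q" using zq by blast
      have \<psi>_gh: "\<psi> (g, snd p) = fst p + g" "\<psi> (h, snd q) = fst q + h"
        using g(2) h(2) by (simp_all add: P_def split: prod.splits)
      have "(g, snd p) = (h, snd q)"
        using g h \<psi>_gh by (intro injD[OF inj]) simp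
      then show ?thesis using g h by (simp add: prod_eq_iff)
    qed
    then show ?thesis unfolding disjoint_family_on_def by blast
  qed
  then have "\<mu> (\<Union>j\<in>J. (+) (fst j) ` P j) = (\<Sum>j\<in>J. \<mu> (P j))"
    using measure_finite_UN[OF add J] inv by simp
  also have "\<dots> = (\<Sum>b\<in>UNIV. \<Sum>s\<in>S. \<mu> (P (s, b)))"
    unfolding J_def using S by (subst sum.swap) (simp add: sum.cartesian_product)
  also have "\<dots> = 2" using pieces by (simp add: UNIV_bool)
  finally have "\<mu> (\<Union>j\<in>J. (+) (fst j) ` P j) = 2" .
  moreover have "\<mu> A \<le> 1" for A
    using add[rule_format, of A "- A"] one pos[of "- A"] by simp
  ultimately have "(2 :: real) \<le> 1" by metis
  then show False by simp
qed

text \<open>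
  If adding the translates by \<open>T\<close> enlarged every finite set by the factor \<open>1 + \<epsilon>\<close>, then sufficiently
  many iterations, which amount to translating by one finite set, would double every finite set. A
  right translation, which does not affect the condition, puts \<open>0\<close> into \<open>K\<close>.
\<close>

lemma amenable_almost_invariant:
  fixes T :: "'g::group_add set" and \<epsilon> :: real
  assumes am: "amenable TYPE('g)" and T: "finite T" and \<epsilon>: "\<epsilon> > 0"
  obtains K where "finite K" "0 \<in> K" "\<And>s. s \<in> T \<Longrightarrow> card {k\<in>K. s + k \<notin> K} \<le> \<epsilon> * card K"
proof -
  define grow where "grow K = K \<union> (\<Union>s\<in>T. (+) s ` K)" for K :: "'g set"
  have grow_fin: "finite (grow K)" if "finite K" for K
    using that T by (simp add: grow_def)
  define S where "S m = (grow ^^ m) {0}" for m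
  have S_0: "S 0 = {0}" and S_Suc: "S (Suc m) = grow (S m)" for m
    by (simp_all add: S_def)
  have S_fin: "finite (S m)" for m
    by (induction m) (simp_all add: S_Suc S_0 grow_fin)
  have S_mult: "(\<Union>s\<in>S m. (+) s ` K) = (grow ^^ m) K" for m and K :: "'g set"
  proof (induction m)
    case 0
    show ?case by (simp add: S_0)
  next
    case (Suc m)
    have "(\<Union>s\<in>S (Suc m). (+) s ` K) = grow (\<Union>s\<in>S m. (+) s ` K)"
      by (auto simp: S_Suc grow_def image_iff add.assoc) (metis add.assoc)+
    then show ?case by (simp add: Suc.IH)
  qed
  have "\<exists>K::'g set. finite K \<and> K \<noteq> {} \<and> card (grow K) \<le> (1 + \<epsilon>) * card K"
  proof (rule ccontr)
    assume "\<not> ?thesis"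
    then have growth: "card (grow K) \<ge> (1 + \<epsilon>) * card K" if "finite K" for K :: "'g set"
      using that by (cases "K = {}") (auto simp: not_le intro: less_imp_le)
    obtain m where m: "(1 + \<epsilon>) ^ m > 2"
      using real_arch_pow[of "1 + \<epsilon>" 2] \<epsilon> by auto
    have pow: "finite ((grow ^^ n) K) \<and> card ((grow ^^ n) K) \<ge> (1 + \<epsilon>) ^ n * card K"
      if "finite K" for n and K :: "'g set"
    proof (induction n)
      case 0
      show ?case using that by simp
    next
      case (Suc n)
      have "(1 + \<epsilon>) ^ Suc n * card K \<le> (1 + \<epsilon>) * card ((grow ^^ n) K)"
        using Suc \<epsilon> by simp
      also have "\<dots> \<le> card (grow ((grow ^^ n) K))" using growth Suc by blast
      finally show ?case using Suc grow_fin by simp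
    qed
    obtain K :: "'g set" where K: "finite K" "card (\<Union>s\<in>S m. (+) s ` K) < 2 * card K"
      using amenable_no_doubling[OF am S_fin] by blast
    have "(1 + \<epsilon>) ^ m * card K < 2 * card K"
      using pow[OF K(1), of m] K(2) unfolding S_mult by linarith
    then show False using m K by (simp add: mult_less_cancel_right)
  qed
  then obtain K0 :: "'g set" where K0: "finite K0" "K0 \<noteq> {}"
    and small: "card (grow K0) \<le> (1 + \<epsilon>) * card K0" by blast
  obtain k0 where k0: "k0 \<in> K0" using K0 by blast
  define K where "K = (\<lambda>k. k - k0) ` K0"
  have inj: "inj_on (\<lambda>k. k - k0) X" for X by (auto simp: inj_on_def)
  show thesis
  proof (rule that[of K])
    show "finite K" "0 \<in> K" using K0 k0 by (force simp: K_def)+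
    fix s assume s: "s \<in> T"
    have mem: "k \<in> K \<longleftrightarrow> k + k0 \<in> K0" for k
      by (auto simp: K_def image_iff) (metis add_diff_cancel)
    have "bij_betw (\<lambda>k. k + k0) {k\<in>K. s + k \<notin> K} {k\<in>K0. s + k \<notin> K0}"
      by (rule bij_betw_byWitness[where f' = "\<lambda>k. k - k0"]) (auto simp: mem add.assoc)
    then have "card {k\<in>K. s + k \<notin> K} = card {k\<in>K0. s + k \<notin> K0}"
      by (rule bij_betw_same_card)
    also have "\<dots> = card ((+) s ` {k\<in>K0. s + k \<notin> K0})"
      by (simp add: card_image inj_on_def)
    finally have eq: "card {k\<in>K. s + k \<notin> K} = card ((+) s ` {k\<in>K0. s + k \<notin> K0})" .
    have "card K0 + card ((+) s ` {k\<in>K0. s + k \<notin> K0}) = card (K0 \<union> (+) s ` {k\<in>K0. s + k \<notin> K0})"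
      using K0 by (intro card_Un_disjoint[symmetric]) auto
    also have "\<dots> \<le> card (grow K0)"
      using s K0 T by (intro card_mono) (auto simp: grow_def)
    finally have "card {k\<in>K. s + k \<notin> K} \<le> \<epsilon> * card K0"
      using small eq by (simp add: algebra_simps)
    then show "card {k\<in>K. s + k \<notin> K} \<le> \<epsilon> * card K"
      by (simp add: K_def card_image inj)
  qed
qed

section \<open>Partial permutation matrices\<close>

lemma mat_adjoint_carrier: "A \<in> carrier_mat d d \<Longrightarrow> mat_adjoint A \<in> carrier_mat d d"
  by (auto simp: mat_adjoint_def)

lemma mat_adjoint_index:
  fixes A :: "complex mat"
  assumes "A \<in> carrier_mat d d" "i < d" "j < d"
  shows "mat_adjoint A $$ (i, j) = cnj (A $$ (j, i))"
  using assms unfolding mat_adjoint_def mat_of_rows_def by simp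

lemma times_mat_index:
  assumes "A \<in> carrier_mat d d" "B \<in> carrier_mat d d" "i < d" "j < d"
  shows "(A * B) $$ (i, j) = (\<Sum>l<d. A $$ (i, l) * B $$ (l, j))"
  using assms by (auto simp: scalar_prod_def atLeast0LessThan intro!: sum.cong)

lemma norm2_sum:
  assumes A: "A \<in> carrier_mat d d"
  shows "norm2 A = sqrt ((\<Sum>j<d. \<Sum>i<d. (cmod (A $$ (i, j)))\<^sup>2) / d)"
proof -
  have "(mat_adjoint A * A) $$ (j, j) = of_real (\<Sum>i<d. (cmod (A $$ (i, j)))\<^sup>2)" if "j < d" for j
    using that A
    by (simp add: times_mat_index[OF mat_adjoint_carrier[OF A] A] mat_adjoint_index[OF A]
        complex_norm_square mult.commute flip: of_real_power)
  then have "ntr (mat_adjoint A * A) = of_real ((\<Sum>j<d. \<Sum>i<d. (cmod (A $$ (i, j)))\<^sup>2) / d)"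
    using mat_adjoint_carrier[OF A] by (auto simp: ntr_def mtrace_def)
  then show ?thesis unfolding norm2_def by (simp only: Re_complex_of_real)
qed

text \<open>
  The entries \<open>n j l\<close> of \<open>V\<^sup>* V\<close> count the common ones of columns \<open>j\<close> and \<open>l\<close>. Comparing the diagonal
  entries of \<open>V\<^sup>* V\<close> and its square gives \<open>(\<Sum>l. (n j l)\<^sup>2) = n j j\<close>. So \<open>n j j \<le> 1\<close> and all other
  \<open>n j l\<close> vanish: a column contains at most one \<open>1\<close>, and so does a row.
\<close>

lemma partial_perm_matsD:
  assumes V: "V \<in> partial_perm_mats d"
  shows "V \<in> carrier_mat d d"
    and "\<And>i j. i < d \<Longrightarrow> j < d \<Longrightarrow> V $$ (i, j) \<in> {0, 1}"
    and "\<And>i i' j. i < d \<Longrightarrow> i' < d \<Longrightarrow> j < d \<Longrightarrow> V $$ (i, j) = 1 \<Longrightarrow> V $$ (i', j) = 1 \<Longrightarrow> i = i'"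
    and "\<And>i j j'. i < d \<Longrightarrow> j < d \<Longrightarrow> j' < d \<Longrightarrow> V $$ (i, j) = 1 \<Longrightarrow> V $$ (i, j') = 1 \<Longrightarrow> j = j'"
proof -
  show C: "V \<in> carrier_mat d d" and
    entries: "\<And>i j. i < d \<Longrightarrow> j < d \<Longrightarrow> V $$ (i, j) \<in> {0, 1}"
    using V by (auto simp: partial_perm_mats_def)
  note adj = mat_adjoint_carrier[OF C]
  define P where "P = mat_adjoint V * V"
  have P: "P \<in> carrier_mat d d" using adj C by (simp add: P_def)
  have PP: "P * P = P"
    using V by (simp add: partial_perm_mats_def partial_isometry_mat_def projection_mat_def P_def)
  define n where "n j l = card {i\<in>{..<d}. V $$ (i, j) = 1 \<and> V $$ (i, l) = 1}" for j l
  have P_index: "P $$ (j, l) = of_nat (n j l)" if "j < d" "l < d" for j l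
  proof -
    have "P $$ (j, l) = (\<Sum>i<d. cnj (V $$ (i, j)) * V $$ (i, l))"
      using that C by (simp add: P_def times_mat_index[OF adj C] mat_adjoint_index[OF C])
    also have "\<dots> = (\<Sum>i<d. if V $$ (i, j) = 1 \<and> V $$ (i, l) = 1 then 1 else 0)"
      using entries that by (intro sum.cong) force+
    finally show ?thesis by (simp add: n_def sum.If_cases Int_def)
  qed
  have idem: "(\<Sum>l<d. (n j l)\<^sup>2) = n j j" if "j < d" for j
  proof -
    have sym: "n j l = n l j" for l by (auto simp: n_def intro: arg_cong[where f = card])
    have "(of_nat (\<Sum>l<d. (n j l)\<^sup>2) :: complex) = (\<Sum>l<d. P $$ (j, l) * P $$ (l, j))"
      using that by (simp add: P_index sym power2_eq_square)
    also have "\<dots> = of_nat (n j j)"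
      using that PP times_mat_index[OF P P that that] by (simp add: P_index)
    finally show ?thesis by (simp only: of_nat_eq_iff)
  qed
  have sq_le: "(n j j)\<^sup>2 \<le> n j j" if "j < d" for j
    using idem[OF that] member_le_sum[of j "{..<d}" "\<lambda>l. (n j l)\<^sup>2"] that by simp
  have diag: "n j j \<le> 1" if "j < d" for j
    using sq_le[OF that] by (cases "n j j") (auto simp: power2_eq_square)
  have offdiag: "n j l = 0" if "j < d" "l < d" "j \<noteq> l" for j l
  proof -
    have "(\<Sum>m\<in>{j, l}. (n j m)\<^sup>2) \<le> (\<Sum>m<d. (n j m)\<^sup>2)"
      using that by (intro sum_mono2) auto
    then have "(n j j)\<^sup>2 + (n j l)\<^sup>2 \<le> n j j" using idem that by simp
    then show ?thesis using diag[OF that(1)] by (cases "n j j") auto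
  qed
  show "i = i'" if "i < d" "i' < d" "j < d" "V $$ (i, j) = 1" "V $$ (i', j) = 1" for i i' j
  proof -
    have "card {i, i'} \<le> n j j"
      unfolding n_def using that by (intro card_mono) auto
    then have "card {i, i'} \<le> 1" using diag that by (meson order_trans)
    then show ?thesis by (cases "i = i'") auto
  qed
  show "j = j'" if "i < d" "j < d" "j' < d" "V $$ (i, j) = 1" "V $$ (i, j') = 1" for i j j'
  proof (rule ccontr)
    assume "j \<noteq> j'"
    then have "n j j' = 0" using offdiag that by blast
    then show False using that by (auto simp: n_def)
  qed
qed

lemma partial_perm_matsI:
  assumes C: "V \<in> carrier_mat d d"
    and entries: "\<And>i j. i < d \<Longrightarrow> j < d \<Longrightarrow> V $$ (i, j) \<in> {0, 1}"
    and col: "\<And>i i' j. i < d \<Longrightarrow> i' < d \<Longrightarrow> j < d \<Longrightarrow> V $$ (i, j) = 1 \<Longrightarrow> V $$ (i', j) = 1 \<Longrightarrow> i = i'"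
    and row: "\<And>i j j'. i < d \<Longrightarrow> j < d \<Longrightarrow> j' < d \<Longrightarrow> V $$ (i, j) = 1 \<Longrightarrow> V $$ (i, j') = 1 \<Longrightarrow> j = j'"
  shows "V \<in> partial_perm_mats d"
proof -
  note adj = mat_adjoint_carrier[OF C]
  define P where "P = mat_adjoint V * V"
  have P: "P \<in> carrier_mat d d" using adj C by (simp add: P_def)
  define c :: "nat \<Rightarrow> complex" where "c j = (if \<exists>i<d. V $$ (i, j) = 1 then 1 else 0)" for j
  have P_index: "P $$ (j, l) = (if j = l then c j else 0)" if jl: "j < d" "l < d" for j l
  proof -
    have sum: "P $$ (j, l) = (\<Sum>i<d. cnj (V $$ (i, j)) * V $$ (i, l))"
      using jl C by (simp add: P_def times_mat_index[OF adj C] mat_adjoint_index[OF C])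
    show ?thesis
    proof (cases "j = l \<and> (\<exists>i<d. V $$ (i, j) = 1)")
      case True
      then have "\<exists>i<d. V $$ (i, j) = 1" by (rule conjunct2)
      then obtain i where i: "i < d" "V $$ (i, j) = 1" by (elim exE conjE)
      have "(\<Sum>i'<d. cnj (V $$ (i', j)) * V $$ (i', l)) = (\<Sum>i'<d. if i' = i then 1 else 0)"
      proof (intro sum.cong refl)
        fix i' assume "i' \<in> {..<d}"
        then show "cnj (V $$ (i', j)) * V $$ (i', l) = (if i' = i then 1 else 0)"
          using True i jl entries[of i' j] col[of i' i j] by (cases "i' = i") auto
      qed
      then show ?thesis using sum True i by (auto simp: c_def)
    next
      case False
      have "(\<Sum>i'<d. cnj (V $$ (i', j)) * V $$ (i', l)) = 0"
      proof (intro sum.neutral ballI)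
        fix i assume "i \<in> {..<d}"
        then show "cnj (V $$ (i, j)) * V $$ (i, l) = 0"
          using False jl entries[of i j] entries[of i l] row[of i j l] by auto
      qed
      then show ?thesis using sum False by (auto simp: c_def)
    qed
  qed
  have "P * P = P"
  proof (rule eq_matI)
    fix i j assume "i < dim_row P" "j < dim_col P"
    then have ij: "i < d" "j < d" using P by auto
    have "(P * P) $$ (i, j) = (\<Sum>l<d. if l = i then P $$ (i, i) * P $$ (i, j) else 0)"
      unfolding times_mat_index[OF P P ij] using ij by (intro sum.cong refl) (simp add: P_index)
    then show "(P * P) $$ (i, j) = P $$ (i, j)" using ij by (auto simp: P_index c_def)
  qed (use P in auto)
  moreover have "mat_adjoint P = P"
    using mat_adjoint_carrier[OF P] P
    by (intro eq_matI) (auto simp: mat_adjoint_index[OF P] P_index c_def)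
  ultimately show ?thesis
    using C entries
    by (auto simp: partial_perm_mats_def partial_isometry_mat_def projection_mat_def P_def)
qed

lemma partial_perm_mats_mult_index:
  assumes A: "A \<in> partial_perm_mats d" and B: "B \<in> partial_perm_mats d" and ij: "i < d" "j < d"
  shows "(A * B) $$ (i, j) = (if \<exists>l<d. A $$ (i, l) = 1 \<and> B $$ (l, j) = 1 then 1 else 0)"
proof -
  note A = partial_perm_matsD[OF A] and B = partial_perm_matsD[OF B]
  have sum: "(A * B) $$ (i, j) = (\<Sum>l<d. A $$ (i, l) * B $$ (l, j))"
    using times_mat_index[OF A(1) B(1)] ij by blast
  show ?thesis
  proof (cases "\<exists>l<d. A $$ (i, l) = 1 \<and> B $$ (l, j) = 1")
    case True
    then obtain l where l: "l < d" "A $$ (i, l) = 1" "B $$ (l, j) = 1" by blast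
    have "(\<Sum>l'<d. A $$ (i, l') * B $$ (l', j)) = (\<Sum>l'<d. if l' = l then 1 else 0)"
    proof (intro sum.cong refl)
      fix l' assume "l' \<in> {..<d}"
      then show "A $$ (i, l') * B $$ (l', j) = (if l' = l then 1 else 0)"
        using l ij A(2)[of i l'] A(4)[of i l' l] by (cases "l' = l") auto
    qed
    then show ?thesis using sum True l by simp
  next
    case False
    have "(\<Sum>l'<d. A $$ (i, l') * B $$ (l', j)) = 0"
    proof (intro sum.neutral ballI)
      fix l' assume "l' \<in> {..<d}"
      then show "A $$ (i, l') * B $$ (l', j) = 0"
        using False ij A(2)[of i l'] B(2)[of l' j] by auto
    qed
    then show ?thesis using sum False by simp
  qed
qed

lemma partial_perm_mats_mult:
  assumes A: "A \<in> partial_perm_mats d" and B: "B \<in> partial_perm_mats d"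
  shows "A * B \<in> partial_perm_mats d"
proof (rule partial_perm_matsI)
  note index = partial_perm_mats_mult_index[OF A B]
  show "A * B \<in> carrier_mat d d"
    using A B by (auto dest!: partial_perm_matsD(1))
  show "(A * B) $$ (i, j) \<in> {0, 1}" if "i < d" "j < d" for i j
    using index[OF that] by simp
  show "i = i'"
    if "i < d" "i' < d" "j < d" "(A * B) $$ (i, j) = 1" "(A * B) $$ (i', j) = 1" for i i' j
    using that index partial_perm_matsD(3)[OF A] partial_perm_matsD(3)[OF B]
    by (metis zero_neq_one)
  show "j = j'"
    if "i < d" "j < d" "j' < d" "(A * B) $$ (i, j) = 1" "(A * B) $$ (i, j') = 1" for i j j'
    using that index partial_perm_matsD(4)[OF A] partial_perm_matsD(4)[OF B]
    by (metis zero_neq_one)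
qed

lemma one_partial_perm_mats: "1\<^sub>m d \<in> partial_perm_mats d"
  by (rule partial_perm_matsI) (auto split: if_splits)

lemma foldr_partial_perm_mats:
  assumes "set As \<subseteq> partial_perm_mats d"
  shows "foldr (*) As (1\<^sub>m d) \<in> partial_perm_mats d"
  using assms by (induction As) (auto simp: one_partial_perm_mats partial_perm_mats_mult)

lemma partial_perm_col_sum_le:
  assumes V: "V \<in> partial_perm_mats d" and j: "j < d"
  shows "(\<Sum>i<d. cmod (V $$ (i, j))) \<le> 1"
proof -
  note V = partial_perm_matsD[OF V]
  let ?I = "{i\<in>{..<d}. V $$ (i, j) = 1}"
  have "(\<Sum>i<d. cmod (V $$ (i, j))) = (\<Sum>i<d. if V $$ (i, j) = 1 then 1 else 0)"
    using V(2) j by (intro sum.cong) force+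
  also have "\<dots> = card ?I" by (simp add: sum.If_cases Int_def)
  finally have "(\<Sum>i<d. cmod (V $$ (i, j))) = card ?I" .
  moreover have "\<forall>a\<in>?I. \<forall>b\<in>?I. a = b" using V(3)[OF _ _ j] by auto
  then have "card ?I \<le> Suc 0" by (subst card_le_Suc0_iff_eq) auto
  ultimately show ?thesis by simp
qed

definition differing_cols :: "nat \<Rightarrow> complex mat \<Rightarrow> complex mat \<Rightarrow> nat set" where
  "differing_cols d A B = {j\<in>{..<d}. \<exists>i<d. A $$ (i, j) \<noteq> B $$ (i, j)}"

text \<open>
  Two partial permutation matrices that agree off a small set of columns are close in norm, and
  conversely (the next lemma), since a differing column contributes between \<open>1\<close> and \<open>2\<close> to
  the sum of the squares of the entries. This turns the metric conditions on a sofic approximation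
  into statements about numbers of points.
\<close>

lemma norm2_partial_perm_diff_le:
  assumes A: "A \<in> partial_perm_mats d" and B: "B \<in> partial_perm_mats d"
  shows "norm2 (A - B) \<le> sqrt (2 * card (differing_cols d A B) / d)"
proof -
  note C = partial_perm_matsD(1)[OF A] partial_perm_matsD(1)[OF B]
  have col: "(\<Sum>i<d. (cmod ((A - B) $$ (i, j)))\<^sup>2) \<le> (if j \<in> differing_cols d A B then 2 else 0)"
    if j: "j < d" for j
  proof (cases "j \<in> differing_cols d A B")
    case True
    have "(\<Sum>i<d. (cmod ((A - B) $$ (i, j)))\<^sup>2) \<le> (\<Sum>i<d. cmod (A $$ (i, j)) + cmod (B $$ (i, j)))"
      using C j partial_perm_matsD(2)[OF A _ j] partial_perm_matsD(2)[OF B _ j]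
      by (intro sum_mono) force
    also have "\<dots> \<le> 2"
      using partial_perm_col_sum_le[OF A j] partial_perm_col_sum_le[OF B j]
      by (simp add: sum.distrib)
    finally show ?thesis using True by simp
  next
    case False
    then have "(\<Sum>i<d. (cmod ((A - B) $$ (i, j)))\<^sup>2) = 0"
      using C j by (intro sum.neutral) (auto simp: differing_cols_def)
    then show ?thesis using False by simp
  qed
  have "(\<Sum>j<d. \<Sum>i<d. (cmod ((A - B) $$ (i, j)))\<^sup>2)
      \<le> (\<Sum>j<d. if j \<in> differing_cols d A B then 2 else 0)"
    using col by (intro sum_mono) auto
  also have "\<dots> = 2 * card (differing_cols d A B)"
    by (simp add: sum.If_cases Int_def differing_cols_def conj_ac)
  finally show ?thesis
    using C by (subst norm2_sum[of _ d]) (auto intro!: divide_right_mono)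
qed

lemma card_differing_cols_le:
  assumes A: "A \<in> partial_perm_mats d" and B: "B \<in> partial_perm_mats d"
    and small: "norm2 (A - B) < \<delta>"
  shows "real (card (differing_cols d A B)) \<le> \<delta>\<^sup>2 * real d"
proof (cases "d = 0")
  case True
  then show ?thesis by (simp add: differing_cols_def)
next
  case False
  note C = partial_perm_matsD(1)[OF A] partial_perm_matsD(1)[OF B]
  have ge1: "(\<Sum>i<d. (cmod ((A - B) $$ (i, j)))\<^sup>2) \<ge> 1" if "j \<in> differing_cols d A B" for j
  proof -
    obtain i where ij: "i < d" "j < d" "A $$ (i, j) \<noteq> B $$ (i, j)"
      using \<open>j \<in> _\<close> by (auto simp: differing_cols_def)
    then have "(cmod ((A - B) $$ (i, j)))\<^sup>2 = 1"
      using C partial_perm_matsD(2)[OF A ij(1,2)] partial_perm_matsD(2)[OF B ij(1,2)] by auto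
    then show ?thesis
      using member_le_sum[of i "{..<d}" "\<lambda>i. (cmod ((A - B) $$ (i, j)))\<^sup>2"] ij by simp
  qed
  have "card (differing_cols d A B) = (\<Sum>j\<in>differing_cols d A B. 1 :: real)" by simp
  also have "\<dots> \<le> (\<Sum>j\<in>differing_cols d A B. \<Sum>i<d. (cmod ((A - B) $$ (i, j)))\<^sup>2)"
    using ge1 by (intro sum_mono) auto
  also have "\<dots> \<le> (\<Sum>j<d. \<Sum>i<d. (cmod ((A - B) $$ (i, j)))\<^sup>2)"
    by (intro sum_mono2) (auto simp: differing_cols_def sum_nonneg)
  also have "\<dots> = (norm2 (A - B))\<^sup>2 * d"
    using False C by (subst norm2_sum[of _ d]) (auto simp: sum_nonneg)
  also have "\<dots> \<le> \<delta>\<^sup>2 * d"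
  proof -
    have "0 \<le> norm2 (A - B)"
      using C by (subst norm2_sum[of _ d]) (auto simp: sum_nonneg)
    then show ?thesis using small by (intro mult_right_mono power_mono) auto
  qed
  finally show ?thesis .
qed

section \<open>Products of group elements in the group algebra\<close>

lemma I_G_mult: "x \<in> I_G \<Longrightarrow> y \<in> I_G \<Longrightarrow> x * y \<in> I_G"
  by (auto simp: I_G_def grp_elem_mult)

lemma one_in_I_G: "1 \<in> I_G"
  unfolding I_G_def single_one[symmetric] by blast

lemma I_G_prod_list: "set ss \<subseteq> I_G \<Longrightarrow> prod_list ss \<in> I_G"
  by (induction ss) (auto simp: I_G_mult one_in_I_G)

lemma I_G_star: "F \<subseteq> I_G \<Longrightarrow> ga_star ` F \<subseteq> I_G"
  by (auto simp: I_G_def ga_star_grp_elem ga_star_zero)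

lemma lookup_mult_grp_elem:
  fixes x :: "'g::group_add group_algebra"
  assumes "x \<in> I_G"
  shows "Poly_Mapping.lookup (x * grp_elem g) (h + g) = Poly_Mapping.lookup x h"
  using assms by (auto simp: I_G_def grp_elem_mult lookup_single when_def)

lemma log_card_mono: "A \<subseteq> B \<Longrightarrow> log_card A \<le> log_card B"
  by (auto simp: log_card_def finite_subset card_mono card_gt_0_iff)

section \<open>Block models on copies of a finite set\<close>

text \<open>
  The left regular representation compressed to copies of a finite set: the point \<open>i\<close> of \<open>W\<close> is
  the element \<open>lab i\<close> in the copy number \<open>blk i\<close>, and a group element \<open>g\<close> moves \<open>lab j\<close> to
  \<open>g + lab j\<close> if that lies in the same copy. Points outside \<open>W\<close> are left over.
\<close>

definition block_rep :: "nat \<Rightarrow> nat set \<Rightarrow> (nat \<Rightarrow> nat) \<Rightarrow> (nat \<Rightarrow> 'g::group_add)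
    \<Rightarrow> 'g group_algebra \<Rightarrow> complex mat" where
  "block_rep d W blk lab x = mat d d (\<lambda>(i, j).
     if i \<in> W \<and> j \<in> W \<and> blk i = blk j then Poly_Mapping.lookup x (lab i - lab j) else 0)"

locale block_model =
  fixes d :: nat and W :: "nat set" and blk :: "nat \<Rightarrow> nat" and lab :: "nat \<Rightarrow> 'g::group_add"
    and Q :: "nat set" and K :: "'g set"
  assumes W: "W \<subseteq> {..<d}"
    and bij: "bij_betw (\<lambda>i. (blk i, lab i)) W (Q \<times> K)"
    and K: "finite K" "K \<noteq> {}"
begin

abbreviation \<rho> :: "'g group_algebra \<Rightarrow> complex mat" where
  "\<rho> \<equiv> block_rep d W blk lab"

lemma finite_W: "finite W"
  using W finite_subset by blast

lemma card_W: "card W = card Q * card K"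
  using bij_betw_same_card[OF bij] by (simp add: card_cartesian_product)

lemma card_W_le: "card W \<le> d"
  using card_mono[OF _ W] by simp

lemma finite_Q: "finite Q"
  using bij_betw_finite[OF bij] finite_W K by (auto simp: finite_cartesian_product_iff)

lemma label_inj: "i \<in> W \<Longrightarrow> j \<in> W \<Longrightarrow> blk i = blk j \<Longrightarrow> lab i = lab j \<Longrightarrow> i = j"
  using bij unfolding bij_betw_def inj_on_def by blast

lemma label_mem: "i \<in> W \<Longrightarrow> blk i \<in> Q \<and> lab i \<in> K"
  using bij unfolding bij_betw_def by auto

lemma label_surj:
  assumes "q \<in> Q" "k \<in> K"
  obtains i where "i \<in> W" "blk i = q" "lab i = k"
proof -
  have "(q, k) \<in> (\<lambda>i. (blk i, lab i)) ` W" using assms bij unfolding bij_betw_def by auto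
  then show thesis using that by auto
qed

lemma rho_index:
  "i < d \<Longrightarrow> j < d \<Longrightarrow> \<rho> x $$ (i, j) =
     (if i \<in> W \<and> j \<in> W \<and> blk i = blk j then Poly_Mapping.lookup x (lab i - lab j) else 0)"
  by (simp add: block_rep_def)

lemma rho_carrier: "\<rho> x \<in> carrier_mat d d"
  by (simp add: block_rep_def)

lemma rho_linear: "linear_to_mat d \<rho>"
  unfolding linear_to_mat_def
proof (intro conjI allI)
  fix x y :: "'g group_algebra" and c :: complex
  show "\<rho> x \<in> carrier_mat d d" by (rule rho_carrier)
  show "\<rho> (x + y) = \<rho> x + \<rho> y"
    by (rule eq_matI) (auto simp: block_rep_def lookup_add)
  show "\<rho> (Poly_Mapping.map ((*) c) x) = c \<cdot>\<^sub>m \<rho> x"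
    by (rule eq_matI) (auto simp: block_rep_def Poly_Mapping.map.rep_eq when_def)
qed

lemma rho_grp_elem:
  assumes "i < d" "j < d"
  shows "\<rho> (grp_elem g) $$ (i, j) =
    (if i \<in> W \<and> j \<in> W \<and> blk i = blk j \<and> lab i = g + lab j then 1 else 0)"
proof -
  have "g = lab i - lab j \<longleftrightarrow> lab i = g + lab j" by (metis add_diff_cancel diff_add_cancel)
  then show ?thesis using assms by (auto simp: rho_index lookup_single when_def)
qed

lemma rho_zero: "\<rho> 0 = 0\<^sub>m d d"
  by (rule eq_matI) (auto simp: block_rep_def)

lemma rho_partial_perm:
  assumes "x \<in> I_G"
  shows "\<rho> x \<in> partial_perm_mats d"
proof -
  have "\<rho> (grp_elem g) \<in> partial_perm_mats d" for g
    by (rule partial_perm_matsI)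
      (auto simp: rho_carrier rho_grp_elem split: if_splits intro: label_inj)
  moreover have "\<rho> 0 \<in> partial_perm_mats d"
    unfolding rho_zero by (rule partial_perm_matsI) auto
  ultimately show ?thesis using assms by (auto simp: I_G_def)
qed

lemma rho_trace: "ntr (\<rho> x) = ga_trace x * of_nat (card W) / of_nat d"
proof -
  have "mtrace (\<rho> x) = (\<Sum>i<d. if i \<in> W then ga_trace x else 0)"
    unfolding mtrace_def using rho_carrier[of x]
    by (intro sum.cong) (auto simp: rho_index ga_trace_def)
  also have "\<dots> = ga_trace x * of_nat (card W)"
    using W by (simp add: sum.If_cases Int_absorb1 mult.commute)
  finally show ?thesis using rho_carrier[of x] by (simp add: ntr_def)
qed

text \<open>
  The points where the block model may fail to act like the group, as far as moves in \<open>T\<close> are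
  concerned.
\<close>

definition exit_points :: "'g set \<Rightarrow> nat set" where
  "exit_points T = ({..<d} - W) \<union> {j\<in>W. \<exists>t\<in>T. t + lab j \<notin> K}"

lemma exit_points_subset: "exit_points T \<subseteq> {..<d}"
  using W by (auto simp: exit_points_def)

lemma card_exit_points:
  fixes \<epsilon> :: real
  assumes T: "finite T" and folner: "\<And>t. t \<in> T \<Longrightarrow> card {k\<in>K. t + k \<notin> K} \<le> \<epsilon> * card K"
    and \<epsilon>: "0 \<le> \<epsilon>"
  shows "real (card (exit_points T)) \<le> (real d - real (card W)) + card T * \<epsilon> * d"
proof -
  have one: "real (card {j\<in>W. t + lab j \<notin> K}) \<le> \<epsilon> * d" if t: "t \<in> T" for t
  proof -
    have "card {j\<in>W. t + lab j \<notin> K} = card ((\<lambda>i. (blk i, lab i)) ` {j\<in>W. t + lab j \<notin> K})"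
      using bij by (intro card_image[symmetric]) (auto simp: bij_betw_def intro: inj_on_subset)
    also have "\<dots> \<le> card (Q \<times> {k\<in>K. t + k \<notin> K})"
      using finite_Q K label_mem by (intro card_mono) auto
    finally have "real (card {j\<in>W. t + lab j \<notin> K}) \<le> card Q * real (card {k\<in>K. t + k \<notin> K})"
      by (simp only: card_cartesian_product flip: of_nat_mult of_nat_le_iff)
    also have "\<dots> \<le> card Q * (\<epsilon> * card K)"
      using folner[OF t] by (intro mult_left_mono) auto
    also have "\<dots> = \<epsilon> * card W" by (simp add: card_W)
    also have "\<dots> \<le> \<epsilon> * d" using \<epsilon> card_W_le by (intro mult_left_mono) auto
    finally show ?thesis .
  qed
  have "card (exit_points T) \<le> card ({..<d} - W) + card (\<Union>t\<in>T. {j\<in>W. t + lab j \<notin> K})"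
  proof -
    have "exit_points T = ({..<d} - W) \<union> (\<Union>t\<in>T. {j\<in>W. t + lab j \<notin> K})"
      by (auto simp: exit_points_def)
    then show ?thesis by (simp add: card_Un_le)
  qed
  also have "card (\<Union>t\<in>T. {j\<in>W. t + lab j \<notin> K}) \<le> (\<Sum>t\<in>T. card {j\<in>W. t + lab j \<notin> K})"
    using T by (rule card_UN_le)
  finally have "real (card (exit_points T))
      \<le> real (card ({..<d} - W)) + (\<Sum>t\<in>T. real (card {j\<in>W. t + lab j \<notin> K}))"
    by (simp flip: of_nat_sum of_nat_add)
  also have "(\<Sum>t\<in>T. real (card {j\<in>W. t + lab j \<notin> K})) \<le> (\<Sum>t\<in>T. \<epsilon> * d)"
    using one by (rule sum_mono)
  also have "real (card ({..<d} - W)) = real d - real (card W)"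
    using W card_W_le finite_W by (simp add: card_Diff_subset of_nat_diff)
  finally show ?thesis by simp
qed

text \<open>
  At a point \<open>j\<close> from which no suffix product leaves the copy of \<open>K\<close>, applying the factors one after
  the other follows the same path as applying the product, so \<open>\<rho>\<close> is multiplicative in column \<open>j\<close>.
\<close>

lemma rho_prod_list:
  assumes "set ss \<subseteq> I_G"
    and "\<And>m. m \<le> length ss \<Longrightarrow> prod_list (drop m ss) \<in> insert 0 (grp_elem ` T)"
    and j: "j < d" "j \<notin> exit_points T" and "i < d"
  shows "foldr (*) (map \<rho> ss) (1\<^sub>m d) $$ (i, j) = \<rho> (prod_list ss) $$ (i, j)"
  using assms
proof (induction ss arbitrary: i)
  case Nil
  have "\<rho> 1 $$ (i, j) = (if i = j then 1 else 0)"
    using Nil rho_grp_elem[of i j 0] by (auto simp: exit_points_def intro: label_inj)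
  then show ?case using Nil by simp
next
  case (Cons s ss)
  define M where "M = foldr (*) (map \<rho> ss) (1\<^sub>m d)"
  have M: "M \<in> carrier_mat d d"
    unfolding M_def using Cons.prems(1) rho_partial_perm
    by (intro partial_perm_matsD(1)[OF foldr_partial_perm_mats]) auto
  have IH: "M $$ (l, j) = \<rho> (prod_list ss) $$ (l, j)" if "l < d" for l
    unfolding M_def
  proof (rule Cons.IH)
    show "prod_list (drop m ss) \<in> insert 0 (grp_elem ` T)" if "m \<le> length ss" for m
      using Cons.prems(2)[of "Suc m"] that by simp
  qed (use Cons.prems that in auto)
  have mult: "(\<rho> s * M) $$ (i, j) = (\<Sum>l<d. \<rho> s $$ (i, l) * \<rho> (prod_list ss) $$ (l, j))"
    unfolding times_mat_index[OF rho_carrier M Cons.prems(5) j(1)] by (intro sum.cong) (auto simp: IH)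
  have "prod_list ss = 0 \<or> (\<exists>t\<in>T. prod_list ss = grp_elem t)"
    using Cons.prems(2)[of 1] by auto
  then have "(\<rho> s * M) $$ (i, j) = \<rho> (s * prod_list ss) $$ (i, j)"
  proof (elim disjE bexE)
    assume "prod_list ss = 0"
    then show ?thesis using Cons.prems(5) j by (simp add: mult rho_zero)
  next
    fix t assume t: "t \<in> T" "prod_list ss = grp_elem t"
    have jW: "j \<in> W" and "t + lab j \<in> K" using j t by (auto simp: exit_points_def)
    then obtain l where l: "l \<in> W" "blk l = blk j" "lab l = t + lab j"
      using label_surj label_mem by metis
    have ld: "l < d" using l W by auto
    have "\<rho> (grp_elem t) $$ (l', j) = (if l' = l then 1 else 0)" if "l' < d" for l'
      using that j l jW by (auto simp: rho_grp_elem intro: label_inj)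
    then have "(\<rho> s * M) $$ (i, j) = (\<Sum>l'<d. if l' = l then \<rho> s $$ (i, l) else 0)"
      unfolding mult t(2) by (intro sum.cong) auto
    also have "\<dots> = \<rho> s $$ (i, l)" using ld by simp
    also have "\<dots> = \<rho> (s * grp_elem t) $$ (i, j)"
    proof -
      have "lab i - lab j = (lab i - (t + lab j)) + t"
        by (simp add: diff_conv_add_uminus minus_add add.assoc del: add_uminus_conv_diff)
      moreover have "s \<in> I_G" using Cons.prems(1) by simp
      ultimately have "Poly_Mapping.lookup (s * grp_elem t) (lab i - lab j)
          = Poly_Mapping.lookup s (lab i - lab l)"
        using lookup_mult_grp_elem l(3) by metis
      then show ?thesis using Cons.prems(5) j ld l jW by (simp add: rho_index)
    qed
    finally show ?thesis using t by simp
  qed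
  then show ?case by (simp add: M_def)
qed

lemma rho_SA:
  fixes \<delta> :: real
  assumes F: "F \<subseteq> I_G" and d: "d > 0"
    and T: "\<And>ss g. length ss \<le> n \<Longrightarrow> set ss \<subseteq> F \<union> ga_star ` F \<Longrightarrow> prod_list ss = grp_elem g \<Longrightarrow> g \<in> T"
    and small: "2 * real (card (exit_points T)) < \<delta>\<^sup>2 * d" "real d - real (card W) < \<delta> * d"
    and \<delta>: "\<delta> > 0"
  shows "\<rho> \<in> SA F n \<delta> d"
proof -
  have FI: "F \<union> ga_star ` F \<subseteq> I_G" using F I_G_star by blast
  have products: "products_upto (F \<union> ga_star ` F) n \<subseteq> I_G"
    unfolding products_upto_def products_def using I_G_prod_list order_trans[OF _ FI] by blast
  have "norm2 (\<rho> (prod_list ss) - foldr (*) (map \<rho> ss) (1\<^sub>m d)) < \<delta>"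
    if ss: "length ss \<le> n" "set ss \<subseteq> F \<union> ga_star ` F" for ss
  proof -
    let ?A = "\<rho> (prod_list ss)" and ?B = "foldr (*) (map \<rho> ss) (1\<^sub>m d)"
    have ssI: "set ss \<subseteq> I_G" using ss FI by blast
    have A: "?A \<in> partial_perm_mats d" using ssI by (intro rho_partial_perm I_G_prod_list)
    have B: "?B \<in> partial_perm_mats d"
      using ssI rho_partial_perm by (intro foldr_partial_perm_mats) auto
    have suffix: "prod_list (drop m ss) \<in> insert 0 (grp_elem ` T)" for m
    proof -
      have sub: "set (drop m ss) \<subseteq> F \<union> ga_star ` F" using ss(2) set_drop_subset by fast
      then have "prod_list (drop m ss) \<in> I_G" using FI by (intro I_G_prod_list) auto
      then show ?thesis using T[of "drop m ss"] sub ss(1) by (auto simp: I_G_def)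
    qed
    have "differing_cols d ?A ?B \<subseteq> exit_points T"
    proof
      fix j assume "j \<in> differing_cols d ?A ?B"
      then obtain i where ij: "i < d" "j < d" "?A $$ (i, j) \<noteq> ?B $$ (i, j)"
        by (auto simp: differing_cols_def)
      show "j \<in> exit_points T"
        using rho_prod_list[OF ssI suffix, where i = i and j = j] ij by metis
    qed
    then have "card (differing_cols d ?A ?B) \<le> card (exit_points T)"
      using exit_points_subset by (intro card_mono) (auto intro: finite_subset)
    then have "2 * card (differing_cols d ?A ?B) / d < \<delta>\<^sup>2"
      using small(1) d by (simp add: divide_simps)
    then have "sqrt (2 * card (differing_cols d ?A ?B) / d) < \<delta>"
      using \<delta> by (intro real_less_lsqrt) auto
    then show ?thesis using norm2_partial_perm_diff_le[OF A B] by linarith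
  qed
  moreover have "\<rho> ` products_upto (F \<union> ga_star ` F) n \<subseteq> partial_perm_mats d"
    using products rho_partial_perm by blast
  moreover have "cmod (ntr (\<rho> s) - ga_trace s) < \<delta>" if "s \<in> products_upto (F \<union> ga_star ` F) n" for s
  proof -
    have "cmod (ga_trace s) \<le> 1"
      using products that by (auto simp: I_G_def ga_trace_grp_elem ga_trace_zero)
    have "ntr (\<rho> s) - ga_trace s = - (ga_trace s * of_real ((real d - real (card W)) / real d))"
      unfolding rho_trace using d by (simp add: divide_simps) (simp add: algebra_simps)
    moreover have "0 \<le> (real d - real (card W)) / d" using card_W_le by simp
    ultimately have "cmod (ntr (\<rho> s) - ga_trace s) = cmod (ga_trace s) * ((real d - real (card W)) / d)"
      by (simp only: norm_minus_cancel norm_mult norm_of_real abs_of_nonneg)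
    also have "\<dots> \<le> 1 * ((real d - real (card W)) / d)"
      using \<open>cmod (ga_trace s) \<le> 1\<close> \<open>0 \<le> _\<close> by (rule mult_right_mono)
    also have "\<dots> < \<delta>" using small(2) d by (simp add: divide_simps)
    finally show ?thesis .
  qed
  ultimately show ?thesis unfolding SA_def using rho_linear by blast
qed

end

section \<open>Counting the conjugates of a block model\<close>

lemma card_le_card_image_mult:
  assumes P: "finite P" and fibre: "\<And>y. y \<in> f ` P \<Longrightarrow> card {p\<in>P. f p = y} \<le> m"
  shows "card P \<le> card (f ` P) * m"
proof -
  have "P = (\<Union>y\<in>f ` P. {p\<in>P. f p = y})" by auto
  then have "card P \<le> (\<Sum>y\<in>f ` P. card {p\<in>P. f p = y})"
    using card_UN_le[of "f ` P" "\<lambda>y. {p\<in>P. f p = y}"] P by simp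
  also have "\<dots> \<le> (\<Sum>y\<in>f ` P. m)" using fibre by (rule sum_mono)
  finally show ?thesis by simp
qed

lemma maximal_disjoint_subfamily:
  assumes G: "finite G" and V: "finite V" and N: "N > 0"
    and S: "\<And>x. x \<in> G \<Longrightarrow> S x \<subseteq> V \<and> card (S x) = N"
  obtains R where "R \<subseteq> G" "card R * N \<le> card V" "\<And>x. x \<in> G \<Longrightarrow> \<exists>r\<in>R. S x \<inter> S r \<noteq> {}"
proof -
  have ne: "S x \<noteq> {}" if "x \<in> G" for x using S[OF that] N by auto
  have "\<exists>R\<subseteq>G. disjoint_family_on S R \<and> (\<forall>x\<in>G. \<exists>r\<in>R. S x \<inter> S r \<noteq> {})"
    using G ne
  proof (induction G rule: finite_induct)
    case empty
    show ?case by (simp add: disjoint_family_on_def)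
  next
    case (insert x G)
    then obtain R where R: "R \<subseteq> G" "disjoint_family_on S R" "\<forall>y\<in>G. \<exists>r\<in>R. S y \<inter> S r \<noteq> {}"
      by (metis insertCI)
    show ?case
    proof (cases "\<exists>r\<in>R. S x \<inter> S r \<noteq> {}")
      case True
      then show ?thesis using R by (intro exI[of _ R]) auto
    next
      case False
      then have "disjoint_family_on S (insert x R)"
        using R(2) unfolding disjoint_family_on_def by blast
      then show ?thesis using R insert.prems by (intro exI[of _ "insert x R"]) auto
    qed
  qed
  then obtain R where R: "R \<subseteq> G" "disjoint_family_on S R" "\<And>x. x \<in> G \<Longrightarrow> \<exists>r\<in>R. S x \<inter> S r \<noteq> {}"
    by blast
  have finR: "finite R" using R(1) G finite_subset by blast
  have "card R * N = (\<Sum>r\<in>R. card (S r))" using S R(1) by (simp add: subset_iff)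
  also have "\<dots> = card (\<Union>r\<in>R. S r)"
  proof (rule card_UN_disjoint'[OF R(2) _ finR, symmetric])
    show "finite (S r)" if "r \<in> R" for r
      using S[of r] R(1) that V by (meson finite_subset subsetD)
  qed
  also have "\<dots> \<le> card V" using V S R(1) by (intro card_mono) auto
  finally show thesis using that R by blast
qed

text \<open>
  A short name is needed because \<open>inv\<close> denotes the inverse of an element of a group.
\<close>

abbreviation pinv :: "('a \<Rightarrow> 'b) \<Rightarrow> 'b \<Rightarrow> 'a" where
  "pinv \<equiv> inv_into UNIV"

context block_model
begin

text \<open>
  The move \<open>s\<close> takes the point \<open>b\<close> to the point \<open>a\<close>.
\<close>

definition step :: "'g \<Rightarrow> nat \<Rightarrow> nat \<Rightarrow> bool" where
  "step s a b \<longleftrightarrow> a \<in> W \<and> b \<in> W \<and> blk a = blk b \<and> lab a = s + lab b"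

lemma permuted:
  assumes p: "p permutes {..<d}"
  shows "block_model d {i. i < d \<and> p i \<in> W} (\<lambda>i. blk (p i)) (\<lambda>i. lab (p i)) Q K"
proof
  show "{i. i < d \<and> p i \<in> W} \<subseteq> {..<d}" by auto
  have "p ` {i. i < d \<and> p i \<in> W} = W"
  proof
    show "W \<subseteq> p ` {i. i < d \<and> p i \<in> W}"
    proof
      fix x assume x: "x \<in> W"
      have "p (pinv p x) = x" using permutes_inverses[OF p] by simp
      moreover have "pinv p x < d"
        using permutes_in_image[OF permutes_inv[OF p], of x] x W by auto
      ultimately show "x \<in> p ` {i. i < d \<and> p i \<in> W}" using x by (intro image_eqI[of x p "pinv p x"]) auto
    qed
  qed auto
  then have "bij_betw p {i. i < d \<and> p i \<in> W} W"
    using permutes_inj[OF p] by (auto simp: bij_betw_def intro: inj_on_subset)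
  from bij_betw_trans[OF this bij]
  show "bij_betw (\<lambda>i. (blk (p i), lab (p i))) {i. i < d \<and> p i \<in> W} (Q \<times> K)"
    by (simp add: comp_def)
qed (use K in auto)

text \<open>
  The conjugate of the block model by \<open>p\<close>: the point \<open>i\<close> plays the role of \<open>p i\<close>.
\<close>

definition twisted :: "(nat \<Rightarrow> nat) \<Rightarrow> 'g group_algebra \<Rightarrow> complex mat" where
  "twisted p = block_rep d {i. i < d \<and> p i \<in> W} (\<lambda>i. blk (p i)) (\<lambda>i. lab (p i))"

lemma twisted_partial_perm:
  assumes p: "p permutes {..<d}"
  shows "twisted p (grp_elem s) \<in> partial_perm_mats d"
  unfolding twisted_def
  by (rule block_model.rho_partial_perm[OF permuted[OF p]]) (simp add: I_G_def)

lemma inv_permutes_less: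
  assumes p: "p permutes {..<d}" and a: "a < d"
  shows "pinv p a < d"
  using permutes_in_image[OF permutes_inv[OF p], of a] a by simp

lemma twisted_inv:
  assumes p: "p permutes {..<d}" and ab: "a < d" "b < d"
  shows "twisted p (grp_elem s) $$ (pinv p a, pinv p b) = (if step s a b then 1 else 0)"
proof -
  have "p (pinv p a) = a" "p (pinv p b) = b"
    using permutes_inverses[OF p] by auto
  then show ?thesis
    unfolding twisted_def
    using block_model.rho_grp_elem[OF permuted[OF p] inv_permutes_less[OF p ab(1)]
        inv_permutes_less[OF p ab(2)], of s] inv_permutes_less[OF p ab(1)] inv_permutes_less[OF p ab(2)]
    by (simp add: step_def)
qed

lemma step_less: "step s a b \<Longrightarrow> a < d \<and> b < d"
  using W by (auto simp: step_def)

text \<open>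
  The common matrix of \<open>s\<close> has a \<open>1\<close> at \<open>(pinv p a, pinv p b)\<close> and at \<open>(pinv p' a, pinv p' b)\<close>, and it
  has at most one \<open>1\<close> in each row and column. So agreement of the two inverses propagates along the
  moves in both directions.
\<close>

lemma twisted_step_determines:
  assumes p: "p permutes {..<d}" and p': "p' permutes {..<d}"
    and eq: "twisted p (grp_elem s) = twisted p' (grp_elem s)"
    and step: "step s a b"
  shows "pinv p a = pinv p' a \<longleftrightarrow> pinv p b = pinv p' b"
proof -
  let ?M = "twisted p (grp_elem s)"
  have ab: "a < d" "b < d" using step_less[OF step] by auto
  have one: "?M $$ (pinv p a, pinv p b) = 1" "?M $$ (pinv p' a, pinv p' b) = 1"
    using twisted_inv[OF p ab, of s] twisted_inv[OF p' ab, of s] step unfolding eq by simp_all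
  note M = partial_perm_matsD(3,4)[OF twisted_partial_perm[OF p]]
  note less = inv_permutes_less[OF p ab(1)] inv_permutes_less[OF p ab(2)]
    inv_permutes_less[OF p' ab(1)] inv_permutes_less[OF p' ab(2)]
  show ?thesis
  proof
    assume "pinv p a = pinv p' a"
    then show "pinv p b = pinv p' b" using M(2)[of "pinv p a" "pinv p b" "pinv p' b" s] one less by simp
  next
    assume "pinv p b = pinv p' b"
    then show "pinv p a = pinv p' a" using M(1)[of "pinv p a" "pinv p' a" "pinv p b" s] one less by simp
  qed
qed

text \<open>
  Let \<open>S x\<close> be the set of points reached from \<open>x\<close> by one move in \<open>E\<close>. It has \<open>card E\<close> points unless
  \<open>x\<close> is an exit point. Take a maximal family of points, none of them an exit point, with disjoint
  sets \<open>S x\<close>; it has at most \<open>d / card E\<close> members. By maximality any other \<open>S x\<close> of full size meets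
  \<open>S r\<close> for a member \<open>r\<close>, so \<open>x\<close> is reached from \<open>r\<close> by a move in \<open>E\<close> and an inverse of one.
  Exit points become roots themselves.
\<close>

lemma exists_roots:
  assumes E: "finite E" "E \<noteq> {}"
  obtains R where "R \<subseteq> {..<d}" "real (card R) \<le> d / card E + card (exit_points E)"
    "\<And>x. x < d \<Longrightarrow> x \<notin> R \<Longrightarrow> \<exists>r\<in>R. \<exists>s\<in>E. \<exists>s'\<in>E. \<exists>y. step s y x \<and> step s' y r"
proof -
  define S where "S x = {a. \<exists>s\<in>E. step s a x}" for x
  define G where "G = {..<d} - exit_points E"
  have S: "S x \<subseteq> {..<d} \<and> card (S x) = card E" if x: "x \<in> G" for x
  proof
    show "S x \<subseteq> {..<d}" using step_less by (auto simp: S_def)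
    have xW: "x \<in> W" and xE: "\<And>s. s \<in> E \<Longrightarrow> s + lab x \<in> K"
      using x by (auto simp: G_def exit_points_def)
    have "bij_betw (\<lambda>a. lab a - lab x) (S x) E"
      unfolding bij_betw_def
    proof
      show "inj_on (\<lambda>a. lab a - lab x) (S x)"
        by (rule inj_onI) (auto simp: S_def step_def intro: label_inj)
      show "(\<lambda>a. lab a - lab x) ` S x = E"
      proof
        show "(\<lambda>a. lab a - lab x) ` S x \<subseteq> E" by (auto simp: S_def step_def)
        show "E \<subseteq> (\<lambda>a. lab a - lab x) ` S x"
        proof
          fix s assume s: "s \<in> E"
          obtain a where a: "a \<in> W" "blk a = blk x" "lab a = s + lab x"
            using label_surj[of "blk x" "s + lab x"] label_mem[OF xW] xE[OF s] by metis
          then have "a \<in> S x" using s xW by (auto simp: S_def step_def)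
          moreover have "s = lab a - lab x" using a by simp
          ultimately show "s \<in> (\<lambda>a. lab a - lab x) ` S x" by (rule rev_image_eqI)
        qed
      qed
    qed
    then show "card (S x) = card E" by (rule bij_betw_same_card)
  qed
  have Epos: "card E > 0" using E by (simp add: card_gt_0_iff)
  obtain R where R: "R \<subseteq> G" "card R * card E \<le> card {..<d}"
    "\<And>x. x \<in> G \<Longrightarrow> \<exists>r\<in>R. S x \<inter> S r \<noteq> {}"
    using maximal_disjoint_subfamily[of G "{..<d}" "card E" S] S Epos by (auto simp: G_def)
  show thesis
  proof (rule that[of "R \<union> exit_points E"])
    show "R \<union> exit_points E \<subseteq> {..<d}" using R(1) exit_points_subset by (auto simp: G_def)
    have "card (R \<union> exit_points E) \<le> card R + card (exit_points E)" by (rule card_Un_le)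
    moreover have "real (card R) \<le> d / card E"
    proof -
      have "real (card R) * real (card E) \<le> real d" using R(2) by (simp flip: of_nat_mult)
      then show ?thesis using Epos by (simp add: pos_le_divide_eq)
    qed
    ultimately show "real (card (R \<union> exit_points E)) \<le> d / card E + card (exit_points E)" by linarith
    fix x assume "x < d" "x \<notin> R \<union> exit_points E"
    then have "x \<in> G" by (simp add: G_def)
    then obtain r where "r \<in> R" "S x \<inter> S r \<noteq> {}" using R(3) by blast
    then show "\<exists>r\<in>R \<union> exit_points E. \<exists>s\<in>E. \<exists>s'\<in>E. \<exists>y. step s y x \<and> step s' y r"
      by (auto simp: S_def)
  qed
qed

text \<open>
  Permutations with equal restricted conjugates are equal if their inverses agree on the roots, so
  at most \<open>d ^ r\<close> of the \<open>d!\<close> permutations give the same restriction.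
\<close>

lemma fact_le_card_twisted:
  assumes E: "finite E" "E \<noteq> {}"
  obtains r where "real r \<le> d / card E + card (exit_points E)"
    "fact d \<le> card ((\<lambda>p. restrict (twisted p) (grp_elem ` E)) ` {p. p permutes {..<d}}) * d ^ r"
proof -
  obtain R where R: "R \<subseteq> {..<d}" "real (card R) \<le> d / card E + card (exit_points E)"
    "\<And>x. x < d \<Longrightarrow> x \<notin> R \<Longrightarrow> \<exists>r\<in>R. \<exists>s\<in>E. \<exists>s'\<in>E. \<exists>y. step s y x \<and> step s' y r"
    using exists_roots[OF E] by blast
  let ?P = "{p. p permutes {..<d}}"
  let ?f = "\<lambda>p. restrict (twisted p) (grp_elem ` E)"
  have finR: "finite R" using R(1) finite_subset by blast
  have finP: "finite ?P" by (rule finite_permutations) simp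
  have cardP: "card ?P = fact d" by (rule card_permutations) simp_all
  have "card {p\<in>?P. ?f p = y} \<le> d ^ card R" for y
  proof -
    let ?g = "\<lambda>p. restrict (pinv p) R"
    have "inj_on ?g {p\<in>?P. ?f p = y}"
    proof (rule inj_onI)
      fix p p' assume "p \<in> {p\<in>?P. ?f p = y}" "p' \<in> {p\<in>?P. ?f p = y}" and g: "?g p = ?g p'"
      then have p: "p permutes {..<d}" and p': "p' permutes {..<d}" and f: "?f p = ?f p'" by auto
      have eq: "twisted p (grp_elem s) = twisted p' (grp_elem s)" if "s \<in> E" for s
        using fun_cong[OF f, of "grp_elem s"] that by simp
      have agreeR: "pinv p r = pinv p' r" if "r \<in> R" for r
        using fun_cong[OF g, of r] that by simp
      have agree: "pinv p x = pinv p' x" for x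
      proof (cases "x < d \<and> x \<notin> R")
        case True
        then obtain r s s' y where "r \<in> R" "s \<in> E" "s' \<in> E" "step s y x" "step s' y r"
          using R(3) by blast
        then show ?thesis
          using twisted_step_determines[OF p p' eq, of s] twisted_step_determines[OF p p' eq, of s']
            agreeR[of r] by metis
      next
        case False
        then show ?thesis
          using agreeR permutes_not_in[OF permutes_inv[OF p], of x]
            permutes_not_in[OF permutes_inv[OF p'], of x] by auto
      qed
      then have "pinv p = pinv p'" by (rule ext)
      then show "p = p'" using permutes_inv_inv[OF p] permutes_inv_inv[OF p'] by metis
    qed
    moreover have "?g ` {p\<in>?P. ?f p = y} \<subseteq> R \<rightarrow>\<^sub>E {..<d}"
      using inv_permutes_less R(1) by (auto simp: restrict_def PiE_iff extensional_def)
    ultimately have "card {p\<in>?P. ?f p = y} \<le> card (R \<rightarrow>\<^sub>E {..<d})"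
      using finR by (intro card_inj_on_le) (auto intro: finite_PiE)
    then show ?thesis using finR by (simp add: card_PiE)
  qed
  then have "fact d \<le> card (?f ` ?P) * d ^ card R"
    using card_le_card_image_mult[OF finP, of ?f] cardP by simp
  then show thesis using that R(2) by blast
qed

end

section \<open>The lower bound\<close>

lemma ln_fact_ge: "real d * ln (real d) - real d \<le> ln (fact d)"
proof (induction d)
  case 0
  show ?case by simp
next
  case (Suc d)
  show ?case
  proof (cases "d = 0")
    case True
    then show ?thesis by simp
  next
    case False
    have "real d * ln (1 + 1 / d) \<le> real d * (1 / d)"
      using ln_add_one_self_le_self[of "1 / d"] by (intro mult_left_mono) auto
    moreover have "ln (1 + 1 / d) = ln (real (Suc d)) - ln d"
    proof -
      have "1 + 1 / real d = real (Suc d) / real d" using False by (simp add: field_simps)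
      then show ?thesis using False by (simp only: ln_div) (simp add: ln_div)
    qed
    ultimately have "real d * ln (real (Suc d)) \<le> real d * ln d + 1"
      using False by (simp add: algebra_simps)
    moreover have "ln (fact (Suc d)) = ln (real (Suc d)) + ln (fact d :: real)"
      by (simp add: ln_mult del: of_nat_Suc)
    moreover have "real (Suc d) * ln (real (Suc d)) = real d * ln (real (Suc d)) + ln (real (Suc d))"
      by (simp add: algebra_simps)
    ultimately show ?thesis using Suc.IH by (simp only: of_nat_Suc)
  qed
qed

lemma inj_grp_elem: "inj (grp_elem :: 'g \<Rightarrow> 'g group_algebra)"
proof (rule injI)
  fix g h :: 'g
  assume "(grp_elem g :: 'g group_algebra) = grp_elem h"
  then have "Poly_Mapping.lookup (grp_elem g :: 'g group_algebra) g = Poly_Mapping.lookup (grp_elem h) g"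
    by simp
  then show "g = h" by (simp add: lookup_single when_def split: if_splits)
qed

context block_model
begin

lemma twisted_SA:
  fixes \<delta> \<epsilon> :: real
  assumes p: "p permutes {..<d}"
    and F: "F \<subseteq> I_G" and d: "d > 0"
    and T: "finite T"
      "\<And>ss g. length ss \<le> n \<Longrightarrow> set ss \<subseteq> F \<union> ga_star ` F \<Longrightarrow> prod_list ss = grp_elem g \<Longrightarrow> g \<in> T"
    and folner: "\<And>t. t \<in> T \<Longrightarrow> card {k\<in>K. t + k \<notin> K} \<le> \<epsilon> * card K" and \<epsilon>: "0 \<le> \<epsilon>"
    and small: "2 * (real d - real (card W) + card T * \<epsilon> * d) < \<delta>\<^sup>2 * d"
      "real d - real (card W) < \<delta> * d"
    and \<delta>: "\<delta> > 0"
  shows "twisted p \<in> SA F n \<delta> d"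
proof -
  interpret p: block_model d "{i. i < d \<and> p i \<in> W}" "\<lambda>i. blk (p i)" "\<lambda>i. lab (p i)" Q K
    by (rule permuted[OF p])
  have W: "card {i. i < d \<and> p i \<in> W} = card W" by (simp add: card_W p.card_W)
  show ?thesis
    unfolding twisted_def
  proof (rule p.rho_SA[OF F d T(2) _ _ \<delta>])
    show "2 * real (card (p.exit_points T)) < \<delta>\<^sup>2 * d"
    proof -
      have "real (card (p.exit_points T)) \<le> (real d - real (card W)) + card T * \<epsilon> * d"
        using p.card_exit_points[OF T(1) _ \<epsilon>] folner unfolding W by blast
      then have "2 * real (card (p.exit_points T)) \<le> 2 * (real d - real (card W) + card T * \<epsilon> * d)"
        by (rule mult_left_mono) simp
      then show ?thesis using small(1) by (rule order.strict_trans1)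
    qed
  qed (use W small in simp_all)
qed

text \<open>
  Count the conjugates: \<open>ln\<close> of their number is at least \<open>ln d! - r * ln d\<close> with \<open>ln d! \<ge> d * ln d - d\<close>
  and \<open>r\<close> at most \<open>d / card E\<close> plus the number of exit points of \<open>E\<close>. The assumptions in \<open>rate\<close> absorb
  the error terms into \<open>\<eta>\<close>.
\<close>

lemma sofic_rate_ge:
  fixes \<delta> \<epsilon> :: real
  assumes E: "finite E" "E \<noteq> {}"
    and F: "F \<subseteq> I_G" and d: "d > 1"
    and T: "finite T"
      "\<And>ss g. length ss \<le> n \<Longrightarrow> set ss \<subseteq> F \<union> ga_star ` F \<Longrightarrow> prod_list ss = grp_elem g \<Longrightarrow> g \<in> T"
    and folner: "\<And>t. t \<in> T \<union> E \<Longrightarrow> card {k\<in>K. t + k \<notin> K} \<le> \<epsilon> * card K" and \<epsilon>: "0 \<le> \<epsilon>"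
    and small: "2 * (real d - real (card W) + card T * \<epsilon> * d) < \<delta>\<^sup>2 * d"
      "real d - real (card W) < \<delta> * d"
    and \<delta>: "\<delta> > 0"
    and rate: "real d + (real d - real (card W)) * ln d \<le> \<eta> / 2 * d * ln d" "card E * \<epsilon> \<le> \<eta> / 2"
  shows "ereal (1 - 1 / card E - \<eta>) \<le> sofic_rate (grp_elem ` E) F n \<delta> d"
proof -
  let ?I = "(\<lambda>p. restrict (twisted p) (grp_elem ` E)) ` {p. p permutes {..<d}}"
  let ?A = "(\<lambda>\<phi>. restrict \<phi> (grp_elem ` E)) ` SA F n \<delta> d"
  have lnd: "ln (real d) > 0" using d by simp
  have fin: "finite {p. p permutes {..<d}}" by (rule finite_permutations) simp
  have "{p. p permutes {..<d}} \<noteq> {}" using permutes_id[of "{..<d}"] by blast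
  then have I: "finite ?I" "?I \<noteq> {}" "card ?I > 0" using fin by (auto simp: card_gt_0_iff)
  obtain r where r: "real r \<le> d / card E + card (exit_points E)" "fact d \<le> card ?I * d ^ r"
    using fact_le_card_twisted[OF E] by blast
  have "ln (fact d) \<le> ln (real (card ?I * d ^ r))"
    using r(2) I(3) d by (subst ln_le_cancel_iff) (simp_all add: of_nat_fact flip: of_nat_le_iff[where 'a = real])
  also have "\<dots> = ln (real (card ?I)) + r * ln d"
    using I(3) d by (simp add: ln_mult ln_realpow)
  finally have "real d * ln d - d \<le> ln (real (card ?I)) + r * ln d"
    using ln_fact_ge[of d] by linarith
  moreover have "r * ln d \<le> (d / card E + (real d - real (card W)) + \<eta> / 2 * d) * ln d"
  proof (rule mult_right_mono)
    have "card E * \<epsilon> * d \<le> \<eta> / 2 * d" using rate(2) by (rule mult_right_mono) simp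
    moreover have "real (card (exit_points E)) \<le> (real d - real (card W)) + card E * \<epsilon> * d"
      using card_exit_points[OF E(1) _ \<epsilon>] folner by blast
    ultimately show "real r \<le> d / card E + (real d - real (card W)) + \<eta> / 2 * d"
      using r(1) by linarith
  qed (use lnd in simp)
  ultimately have "(1 - 1 / card E - \<eta>) * (real d * ln d) \<le> ln (real (card ?I))"
    using rate(1) by (simp add: algebra_simps)
  then have "ereal (1 - 1 / card E - \<eta>) \<le> ereal (ln (real (card ?I)) / (real d * ln d))"
    using d lnd by (simp add: pos_le_divide_eq)
  also have "\<dots> = log_card ?I / ereal (real d * ln d)"
    using I lnd d by (simp add: log_card_def)
  also have "\<dots> \<le> log_card ?A / ereal (real d * ln d)"
  proof (rule ereal_divide_right_mono)
    have "twisted p \<in> SA F n \<delta> d" if "p permutes {..<d}" for p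
    proof (rule twisted_SA[OF that F _ T(1) _ _ \<epsilon> small \<delta>])
      show "g \<in> T" if "length ss \<le> n" "set ss \<subseteq> F \<union> ga_star ` F" "prod_list ss = grp_elem g" for ss g
        using that by (rule T(2))
      show "card {k\<in>K. t + k \<notin> K} \<le> \<epsilon> * card K" if "t \<in> T" for t
        using that by (intro folner) simp
    qed (use d in simp)
    then show "log_card ?I \<le> log_card ?A" by (intro log_card_mono) auto
  qed (use d lnd in simp)
  finally show ?thesis unfolding sofic_rate_def .
qed

end

lemma block_model_exists:
  fixes K :: "'g::group_add set"
  assumes K: "finite K" "K \<noteq> {}"
  obtains W blk lab Q where "block_model d W blk lab Q K" "d \<le> card W + card K"
proof -
  define m where "m = card K"
  define q where "q = d div m"
  define W where "W = {..<q * m}"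
  have "card W = card ({..<q} \<times> K)" by (simp add: W_def m_def card_cartesian_product)
  then obtain u where u: "bij_betw u W ({..<q} \<times> K)"
    using finite_same_card_bij[of W "{..<q} \<times> K"] K by (auto simp: W_def)
  have "q * m \<le> d" by (simp add: q_def)
  then have "block_model d W (\<lambda>i. fst (u i)) (\<lambda>i. snd (u i)) {..<q} K"
    using u K by unfold_locales (auto simp: W_def)
  moreover have "d \<le> card W + card K"
  proof -
    have "m > 0" using K by (simp add: m_def card_gt_0_iff)
    have "d = q * m + d mod m" by (simp add: q_def)
    also have "d mod m \<le> m" using \<open>m > 0\<close> by (simp add: less_imp_le)
    finally show ?thesis by (simp add: W_def m_def)
  qed
  ultimately show thesis by (rule that)
qed

text \<open>
  The set \<open>T\<close> collects the group elements that occur as products of at most \<open>n\<close> factors. A Folner set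
  for \<open>T \<union> E\<close> is chosen once; its copies cover all but \<open>card K\<close> of the \<open>d\<close> points, so the same
  \<open>K\<close> serves all large \<open>d\<close>, as a bound on the limit inferior requires.
\<close>

lemma amenable_liminf_sofic_rate:
  fixes E :: "'g::group_add set" and \<eta> \<delta> :: real
  assumes am: "amenable TYPE('g)" and E: "finite E" "E \<noteq> {}"
    and F: "finite F" "F \<subseteq> I_G" and \<delta>: "\<delta> > 0" and \<eta>: "\<eta> > 0"
  shows "ereal (1 - 1 / card E - \<eta>) \<le> liminf (sofic_rate (grp_elem ` E) F n \<delta>)"
proof -
  define T :: "'g set" where
    "T = grp_elem -` prod_list ` {ss. set ss \<subseteq> F \<union> ga_star ` F \<and> length ss \<le> n}"
  have T: "finite T"
    unfolding T_def using F(1) by (intro finite_vimageI[OF _ inj_grp_elem] finite_imageI finite_lists_length_le) auto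
  have T': "g \<in> T" if "length ss \<le> n" "set ss \<subseteq> F \<union> ga_star ` F" "prod_list ss = grp_elem g" for ss g
    unfolding T_def using that by (intro vimageI2 image_eqI[of _ _ ss]) auto
  \<comment> \<open>The first term keeps the defect of multiplicativity below \<open>\<delta>\<close>, the second lets the exit points
    of \<open>E\<close> cost at most \<open>\<eta> / 2\<close>.\<close>
  define \<epsilon> where "\<epsilon> = min (\<delta>\<^sup>2 / (4 * (card T + 1))) (\<eta> / (2 * card E))"
  have Epos: "real (card E) > 0" using E by (simp add: card_gt_0_iff)
  have \<epsilon>: "\<epsilon> > 0" unfolding \<epsilon>_def using \<delta> \<eta> Epos by (intro min_less_iff_conj[THEN iffD2] conjI divide_pos_pos) auto
  have \<epsilon>T: "card T * \<epsilon> \<le> \<delta>\<^sup>2 / 4"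
  proof -
    have "card T * \<epsilon> \<le> (card T + 1) * (\<delta>\<^sup>2 / (4 * (card T + 1)))"
      using \<epsilon> by (intro mult_mono) (auto simp: \<epsilon>_def)
    also have "\<dots> = \<delta>\<^sup>2 / 4"
      by (simp only: of_nat_mult of_nat_numeral) (simp add: field_simps del: of_nat_add)
    finally show ?thesis .
  qed
  have \<epsilon>E: "card E * \<epsilon> \<le> \<eta> / 2"
  proof -
    have "card E * \<epsilon> \<le> card E * (\<eta> / (2 * card E))" by (intro mult_left_mono) (auto simp: \<epsilon>_def)
    also have "\<dots> = \<eta> / 2" using Epos by simp
    finally show ?thesis .
  qed
  obtain K where K: "finite K" "0 \<in> K"
    and folner: "\<And>s. s \<in> T \<union> E \<Longrightarrow> card {k\<in>K. s + k \<notin> K} \<le> \<epsilon> * card K"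
    using amenable_almost_invariant[OF am, of "T \<union> E" \<epsilon>] T E \<epsilon> by (metis finite_UnI)
  define m where "m = real (card K)"
  have "\<forall>\<^sub>F d in sequentially. real d > 1" by real_asymp
  moreover have "\<forall>\<^sub>F d in sequentially. 4 * m < \<delta>\<^sup>2 * real d" using \<delta> by real_asymp
  moreover have "\<forall>\<^sub>F d in sequentially. m < \<delta> * real d" using \<delta> by real_asymp
  moreover have "\<forall>\<^sub>F d in sequentially. real d + m * ln (real d) \<le> \<eta> / 2 * real d * ln (real d)"
    using \<eta> by real_asymp
  ultimately have "\<forall>\<^sub>F d in sequentially. real d > 1 \<and> 4 * m < \<delta>\<^sup>2 * real d \<and> m < \<delta> * real d
      \<and> real d + m * ln (real d) \<le> \<eta> / 2 * real d * ln (real d)"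
    by (intro eventually_conj)
  then show ?thesis
  proof (intro Liminf_bounded, elim eventually_mono)
    fix d :: nat
    assume "real d > 1 \<and> 4 * m < \<delta>\<^sup>2 * real d \<and> m < \<delta> * real d
      \<and> real d + m * ln (real d) \<le> \<eta> / 2 * real d * ln (real d)"
    then have d: "real d > 1" "4 * m < \<delta>\<^sup>2 * real d" "m < \<delta> * real d"
      "real d + m * ln (real d) \<le> \<eta> / 2 * real d * ln (real d)"
      by simp_all
    obtain W blk lab Q where bm: "block_model d W blk lab Q K" and W: "d \<le> card W + card K"
      using block_model_exists[OF K(1)] K(2) by blast
    have Wm: "real d - real (card W) \<le> m" using W by (simp add: m_def)
    show "ereal (1 - 1 / card E - \<eta>) \<le> sofic_rate (grp_elem ` E) F n \<delta> d"
    proof (rule block_model.sofic_rate_ge[OF bm E F(2) _ T T' folner])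
      have half: "2 * (a + x) < y" if "4 * x \<le> y" "4 * b < y" "a \<le> b" for a b x y :: real
        using that by argo
      define X where "X = real (card T) * \<epsilon> * real d"
      define Y where "Y = \<delta>\<^sup>2 * real d"
      have "X \<le> \<delta>\<^sup>2 / 4 * real d" unfolding X_def using \<epsilon>T by (rule mult_right_mono) simp
      then have "4 * X \<le> Y" by (simp add: Y_def)
      then have "2 * (real d - real (card W) + X) < Y"
        using half[OF _ _ Wm] d(2) unfolding Y_def[symmetric] by blast
      then show "2 * (real d - real (card W) + card T * \<epsilon> * d) < \<delta>\<^sup>2 * d"
        unfolding X_def Y_def .
      have "(real d - real (card W)) * ln d \<le> m * ln d"
        using Wm d(1) by (intro mult_right_mono) auto
      then show "real d + (real d - real (card W)) * ln d \<le> \<eta> / 2 * d * ln d" using d(4) by linarith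
    qed (use d \<epsilon> \<epsilon>E \<delta> Wm in auto)
  qed
qed

section \<open>Random leaders\<close>

definition leader :: "(nat \<Rightarrow> nat) \<Rightarrow> nat set \<Rightarrow> nat" where
  "leader \<pi> A = arg_min_on \<pi> A"

lemma leader_mem: "finite A \<Longrightarrow> A \<noteq> {} \<Longrightarrow> leader \<pi> A \<in> A"
  unfolding leader_def by (rule arg_min_if_finite)

lemma leader_le: "finite A \<Longrightarrow> x \<in> A \<Longrightarrow> \<pi> (leader \<pi> A) \<le> \<pi> x"
  unfolding leader_def by (intro arg_min_least) auto

lemma leader_eqI:
  assumes "inj \<pi>" "finite A" "a \<in> A" "\<And>b. b \<in> A \<Longrightarrow> \<pi> a \<le> \<pi> b"
  shows "leader \<pi> A = a"
proof -
  have "leader \<pi> A \<in> A" using leader_mem assms(2,3) by blast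
  then have "\<pi> (leader \<pi> A) = \<pi> a"
    using leader_le[OF assms(2,3)] assms(4) by (meson le_antisym)
  then show ?thesis by (rule injD[OF assms(1)])
qed

text \<open>
  A leader of the union that lies in both sets leads each of them. So a random order separates the
  leaders of two sets only if the leader of their union is outside their intersection.
\<close>

lemma leader_Un:
  assumes "inj \<pi>" "finite A" "finite B" "leader \<pi> (A \<union> B) \<in> A \<inter> B"
  shows "leader \<pi> A = leader \<pi> B"
proof -
  have le: "\<pi> (leader \<pi> (A \<union> B)) \<le> \<pi> x" if "x \<in> A \<union> B" for x
    using leader_le[of "A \<union> B"] assms(2,3) that by simp
  have "leader \<pi> A = leader \<pi> (A \<union> B)" "leader \<pi> B = leader \<pi> (A \<union> B)"
    using assms le by (auto intro!: leader_eqI)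
  then show ?thesis by simp
qed

text \<open>
  Composition with the transposition of \<open>a\<close> and \<open>b\<close> exchanges the orders led by \<open>a\<close> with those led by
  \<open>b\<close>: all elements of \<open>A\<close> are equally likely to be the leader.
\<close>

lemma card_leader_swap:
  assumes V: "finite V" and A: "A \<subseteq> V" "a \<in> A" "b \<in> A"
  shows "card {\<pi>. \<pi> permutes V \<and> leader \<pi> A = a} = card {\<pi>. \<pi> permutes V \<and> leader \<pi> A = b}"
proof -
  let ?t = "transpose a b"
  have finA: "finite A" using V A finite_subset by blast
  have tA: "?t x \<in> A \<longleftrightarrow> x \<in> A" for x using A by (auto simp: transpose_def)
  have tt: "\<pi> \<circ> ?t \<circ> ?t = \<pi>" for \<pi> :: "nat \<Rightarrow> nat" by (simp add: fun_eq_iff)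
  have tV: "?t permutes V" using A by (intro permutes_swap_id) auto
  have leader_t: "leader (\<pi> \<circ> ?t) A = ?t (leader \<pi> A)" if \<pi>: "\<pi> permutes V" for \<pi>
  proof (rule leader_eqI[OF _ finA])
    show "inj (\<pi> \<circ> ?t)" using permutes_inj[OF permutes_compose[OF tV \<pi>]] .
    show "?t (leader \<pi> A) \<in> A" using leader_mem[OF finA] A tA by auto
    show "(\<pi> \<circ> ?t) (?t (leader \<pi> A)) \<le> (\<pi> \<circ> ?t) x" if "x \<in> A" for x
      using leader_le[OF finA, of "?t x" \<pi>] that tA by simp
  qed
  have "bij_betw (\<lambda>\<pi>. \<pi> \<circ> ?t) {\<pi>. \<pi> permutes V \<and> leader \<pi> A = a} {\<pi>. \<pi> permutes V \<and> leader \<pi> A = b}"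
  proof (rule bij_betw_byWitness[where f' = "\<lambda>\<pi>. \<pi> \<circ> ?t"])
    show "(\<lambda>\<pi>. \<pi> \<circ> ?t) ` {\<pi>. \<pi> permutes V \<and> leader \<pi> A = a} \<subseteq> {\<pi>. \<pi> permutes V \<and> leader \<pi> A = b}"
      by (rule image_subsetI) (simp add: leader_t permutes_compose[OF tV])
    show "(\<lambda>\<pi>. \<pi> \<circ> ?t) ` {\<pi>. \<pi> permutes V \<and> leader \<pi> A = b} \<subseteq> {\<pi>. \<pi> permutes V \<and> leader \<pi> A = a}"
      by (rule image_subsetI) (simp add: leader_t permutes_compose[OF tV])
  qed (simp_all add: tt)
  then show ?thesis by (rule bij_betw_same_card)
qed

lemma card_leader_sum:
  assumes V: "finite V" and B: "finite B"
  shows "card {\<pi>. \<pi> permutes V \<and> leader \<pi> A \<in> B}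
    = (\<Sum>b\<in>B. card {\<pi>. \<pi> permutes V \<and> leader \<pi> A = b})"
proof -
  have "{\<pi>. \<pi> permutes V \<and> leader \<pi> A \<in> B} = (\<Union>b\<in>B. {\<pi>. \<pi> permutes V \<and> leader \<pi> A = b})"
    by auto
  also have "card \<dots> = (\<Sum>b\<in>B. card {\<pi>. \<pi> permutes V \<and> leader \<pi> A = b})"
  proof (rule card_UN_disjoint'[OF _ _ B])
    show "disjoint_family_on (\<lambda>b. {\<pi>. \<pi> permutes V \<and> leader \<pi> A = b}) B"
      by (auto simp: disjoint_family_on_def)
    show "finite {\<pi>. \<pi> permutes V \<and> leader \<pi> A = b}" for b
      by (rule finite_subset[OF _ finite_permutations[OF V]]) auto
  qed
  finally show ?thesis .
qed

lemma card_leader_eq: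
  assumes V: "finite V" and A: "A \<subseteq> V" "a \<in> A"
  shows "card {\<pi>. \<pi> permutes V \<and> leader \<pi> A = a} * card A = fact (card V)"
proof -
  have finA: "finite A" using finite_subset[OF A(1) V] .
  have "leader \<pi> A \<in> A" for \<pi> using leader_mem[OF finA] A(2) by blast
  then have "{\<pi>. \<pi> permutes V} = {\<pi>. \<pi> permutes V \<and> leader \<pi> A \<in> A}" by simp
  moreover have "fact (card V) = card {\<pi>. \<pi> permutes V}"
    using V by (simp add: card_permutations[OF refl])
  ultimately have "fact (card V) = (\<Sum>b\<in>A. card {\<pi>. \<pi> permutes V \<and> leader \<pi> A = b})"
    using card_leader_sum[OF V finA] by simp
  also have "\<dots> = (\<Sum>b\<in>A. card {\<pi>. \<pi> permutes V \<and> leader \<pi> A = a})"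
    by (intro sum.cong refl card_leader_swap[OF V A(1)] A(2))
  finally show ?thesis by (simp add: mult.commute)
qed

lemma card_leader_in:
  assumes V: "finite V" and A: "A \<subseteq> V" and B: "B \<subseteq> A"
  shows "card {\<pi>. \<pi> permutes V \<and> leader \<pi> A \<in> B} * card A = card B * fact (card V)"
proof -
  have finB: "finite B" using finite_subset[OF B finite_subset[OF A V]] .
  have "card {\<pi>. \<pi> permutes V \<and> leader \<pi> A \<in> B} * card A
      = (\<Sum>b\<in>B. card {\<pi>. \<pi> permutes V \<and> leader \<pi> A = b} * card A)"
    by (simp add: card_leader_sum[OF V finB] sum_distrib_right)
  also have "\<dots> = (\<Sum>b\<in>B. fact (card V))"
    using card_leader_eq[OF V A] B by (intro sum.cong) auto
  finally show ?thesis by simp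
qed

lemma sum_card_swap:
  assumes "finite P" "finite V"
  shows "(\<Sum>p\<in>P. card {x\<in>V. Q p x}) = (\<Sum>x\<in>V. card {p\<in>P. Q p x})"
proof -
  have "(\<Sum>p\<in>P. card {x\<in>V. Q p x}) = (\<Sum>p\<in>P. \<Sum>x\<in>V. if Q p x then 1 else 0)"
    using assms by (simp add: sum.If_cases Int_def)
  also have "\<dots> = (\<Sum>x\<in>V. \<Sum>p\<in>P. if Q p x then 1 else 0)" by (rule sum.swap)
  finally show ?thesis using assms by (simp add: sum.If_cases Int_def)
qed

lemma exists_le_average:
  fixes f :: "'a \<Rightarrow> real" and M :: real
  assumes "finite P" "P \<noteq> {}" "(\<Sum>p\<in>P. f p) \<le> card P * M"
  shows "\<exists>p\<in>P. f p \<le> M"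
proof (rule ccontr)
  assume "\<not> ?thesis"
  then have "(\<Sum>p\<in>P. M) < (\<Sum>p\<in>P. f p)"
    using assms by (intro sum_strict_mono) auto
  then show False using assms(3) by simp
qed

section \<open>Almost actions\<close>

text \<open>
  An approximate free action on \<open>d\<close> points: \<open>R g i j\<close> means that \<open>g\<close> moves \<open>j\<close> to \<open>i\<close>. Every \<open>g \<in> S\<close>
  acts by a partial injection, and outside of the exceptional set \<open>X\<close> the identity fixes the point,
  products act as they should, and no other element of \<open>S\<close> fixes the point. Totality of the moves at
  points outside \<open>X\<close> follows, because \<open>- g + g\<close> acts as the identity.
\<close>

locale almost_action =
  fixes S :: "'g::group_add set" and d :: nat and R :: "'g \<Rightarrow> nat \<Rightarrow> nat \<Rightarrow> bool" and X :: "nat set"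
  assumes R_less: "R g i j \<Longrightarrow> i < d \<and> j < d"
    and R_func: "g \<in> S \<Longrightarrow> R g i j \<Longrightarrow> R g i' j \<Longrightarrow> i = i'"
    and R_inj: "g \<in> S \<Longrightarrow> R g i j \<Longrightarrow> R g i j' \<Longrightarrow> j = j'"
    and X: "X \<subseteq> {..<d}"
    and S_zero: "0 \<in> S" and S_uminus: "g \<in> S \<Longrightarrow> - g \<in> S"
    and R_zero: "j < d \<Longrightarrow> j \<notin> X \<Longrightarrow> R 0 j j"
    and R_comp: "j < d \<Longrightarrow> j \<notin> X \<Longrightarrow> g \<in> S \<Longrightarrow> h \<in> S \<Longrightarrow> R (g + h) i j \<longleftrightarrow> (\<exists>l. R g i l \<and> R h l j)"
    and R_free: "j < d \<Longrightarrow> j \<notin> X \<Longrightarrow> g \<in> S \<Longrightarrow> R g j j \<Longrightarrow> g = 0"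
begin

definition act :: "'g \<Rightarrow> nat \<Rightarrow> nat" where
  "act g j = (THE i. R g i j)"

lemma act_eq: "g \<in> S \<Longrightarrow> R g i j \<Longrightarrow> act g j = i"
  unfolding act_def using R_func by blast

lemma R_act:
  assumes "j < d" "j \<notin> X" "g \<in> S"
  shows "R g (act g j) j"
proof -
  have "R (- g + g) j j" using R_zero assms by simp
  then obtain i where "R g i j" using R_comp[OF assms(1,2) S_uminus[OF assms(3)] assms(3)] by blast
  then show ?thesis using act_eq assms(3) by blast
qed

lemma R_act_act:
  assumes "j < d" "j \<notin> X" "g \<in> S" "h \<in> S" "g + h \<in> S"
  shows "R g (act (g + h) j) (act h j)"
proof -
  have "R (g + h) (act (g + h) j) j" using R_act assms by blast
  then obtain l where "R g (act (g + h) j) l" "R h l j" using R_comp assms by blast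
  then show ?thesis using act_eq assms by blast
qed

lemma act_inj:
  assumes j: "j < d" "j \<notin> X" and gh: "g \<in> S" "h \<in> S" "- h + g \<in> S" and eq: "act g j = act h j"
  shows "g = h"
proof -
  have "R (- h + h) j j" using R_zero j by simp
  then obtain l where "R (- h) j l" "R h l j" using R_comp[OF j S_uminus[OF gh(2)] gh(2)] by blast
  then have "R (- h) j (act g j)" using act_eq gh(2) eq by metis
  then have "R (- h + g) j j" using R_comp[OF j S_uminus[OF gh(2)] gh(1)] R_act[OF j gh(1)] by blast
  then have "- h + g = 0" using R_free j gh(3) by blast
  then show ?thesis by (metis add.assoc add.right_neutral add_0 right_minus)
qed

end

text \<open>
  The set \<open>S\<close> on which the action is controlled is large enough for the arguments below to
  move points by \<open>- k\<close> and \<open>- k + s\<close> and to compare two such moves by freeness.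
\<close>

locale folner_action = almost_action S d R X
  for S :: "'g::group_add set" and d R X +
  fixes K E :: "'g set" and \<epsilon> :: real
  assumes K: "finite K" "0 \<in> K" and E: "finite E" "E \<subseteq> S"
    and KE: "k \<in> K \<Longrightarrow> s \<in> insert 0 E \<Longrightarrow> - k + s \<in> S"
    and KE2: "k \<in> K \<Longrightarrow> s \<in> insert 0 E \<Longrightarrow> k' \<in> K \<Longrightarrow> s' \<in> insert 0 E \<Longrightarrow> - (- k' + s') + (- k + s) \<in> S"
    and folner: "s \<in> E \<Longrightarrow> card {k\<in>K. s + k \<notin> K} \<le> \<epsilon> * card K"
    and \<epsilon>: "0 \<le> \<epsilon>"
begin

text \<open>
  The candidates for the cluster of \<open>x\<close>: the centers \<open>z\<close> of the translated copies \<open>K \<cdot> z\<close> that contain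
  \<open>x\<close>.
\<close>

definition cand :: "nat \<Rightarrow> nat set" where
  "cand x = (\<lambda>k. act (- k) x) ` K"

lemma uminus_K: "k \<in> K \<Longrightarrow> - k \<in> S"
  using KE[of k 0] by simp

lemma inj_translate:
  assumes x: "x < d" "x \<notin> X" and s: "s \<in> insert 0 E"
  shows "inj_on (\<lambda>k. act (- k + s) x) K"
proof (rule inj_onI)
  fix k k' assume k: "k \<in> K" "k' \<in> K" "act (- k + s) x = act (- k' + s) x"
  have "- k + s = - k' + s"
    using act_inj[OF x KE KE KE2] k s by blast
  then show "k = k'" by simp
qed

lemma cand_good:
  assumes x: "x < d" "x \<notin> X"
  shows "cand x \<subseteq> {..<d}" "finite (cand x)" "card (cand x) = card K" "x \<in> cand x"
proof -
  show "cand x \<subseteq> {..<d}" using R_less[OF R_act[OF x uminus_K]] by (auto simp: cand_def)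
  show "finite (cand x)" using K by (simp add: cand_def)
  show "card (cand x) = card K"
    unfolding cand_def using inj_translate[OF x, of 0] by (intro card_image) simp
  have "act 0 x = x" using act_eq[OF S_zero R_zero[OF x]] .
  then show "x \<in> cand x" unfolding cand_def using K(2) by (intro image_eqI[of _ _ 0]) auto
qed

lemma cand_step:
  assumes x: "x < d" "x \<notin> X" and s: "s \<in> E" and R: "R s y x" and k: "k \<in> K"
  shows "act (- k) y = act (- k + s) x"
proof -
  have sS: "s \<in> S" using s E by blast
  have "R (- k) (act (- k + s) x) (act s x)"
    using R_act_act[OF x uminus_K sS] KE k s by blast
  moreover have "act s x = y" using act_eq[OF sS R] .
  ultimately show ?thesis using act_eq[OF uminus_K] k by blast
qed

text \<open>
  The candidates of \<open>y = s \<cdot> x\<close> are the points \<open>(- k + s) \<cdot> x\<close>. The candidate \<open>- k \<cdot> x\<close> of \<open>x\<close> is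
  among them whenever \<open>s + k \<in> K\<close>, which fails for at most \<open>\<epsilon> * card K\<close> elements \<open>k\<close>.
\<close>

lemma card_cand_Int:
  assumes x: "x < d" "x \<notin> X" and s: "s \<in> E" and R: "R s y x"
  shows "real (card (cand x \<inter> cand y)) \<ge> (1 - \<epsilon>) * card K"
proof -
  let ?I = "{k\<in>K. s + k \<in> K}"
  have "(\<lambda>k. act (- k) x) ` ?I \<subseteq> cand x \<inter> cand y"
  proof
    fix z assume "z \<in> (\<lambda>k. act (- k) x) ` ?I"
    then obtain k where k: "k \<in> K" "s + k \<in> K" "z = act (- k) x" by auto
    have "- (s + k) + s = - k" by (simp add: minus_add add.assoc)
    then have "act (- (s + k)) y = z" using cand_step[OF x s R k(2)] k(3) by simp
    then have "z \<in> cand y" unfolding cand_def using k(2) by (metis image_eqI)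
    moreover have "z \<in> cand x" unfolding cand_def using k by blast
    ultimately show "z \<in> cand x \<inter> cand y" by blast
  qed
  then have "card ((\<lambda>k. act (- k) x) ` ?I) \<le> card (cand x \<inter> cand y)"
    using cand_good(2)[OF x] by (intro card_mono) auto
  moreover have "card ((\<lambda>k. act (- k) x) ` ?I) = card ?I"
    using inj_translate[OF x, of 0] by (intro card_image) (auto intro: inj_on_subset)
  moreover have "card ?I = card K - card {k\<in>K. s + k \<notin> K}"
  proof -
    have "?I = K - {k\<in>K. s + k \<notin> K}" by auto
    then show ?thesis using K by (simp add: card_Diff_subset)
  qed
  moreover have "card {k\<in>K. s + k \<notin> K} \<le> card K" using K by (intro card_mono) auto
  ultimately have "real (card (cand x \<inter> cand y)) \<ge> real (card K) - real (card {k\<in>K. s + k \<notin> K})"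
    by linarith
  then show ?thesis using folner[OF s] by (simp add: algebra_simps)
qed

text \<open>
  With \<open>A\<close> the union and \<open>C\<close> the intersection of the two candidate sets, the leader of \<open>A\<close> is outside
  \<open>C\<close> with probability \<open>card (A - C) / card A\<close>. Here \<open>card (A - C) = 2 * card K - 2 * card C\<close>
  is at most \<open>2 * \<epsilon> * card K\<close>, and \<open>card A \<ge> card K\<close>.
\<close>

lemma card_leader_differs:
  assumes x: "x < d" "x \<notin> X" and y: "y < d" "y \<notin> X" and s: "s \<in> E" and R: "R s y x"
  shows "real (card {\<pi>. \<pi> permutes {..<d} \<and> leader \<pi> (cand x) \<noteq> leader \<pi> (cand y)}) \<le> 2 * \<epsilon> * fact d"
proof -
  let ?A = "cand x \<union> cand y" and ?C = "cand x \<inter> cand y"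
  let ?P = "{\<pi>. \<pi> permutes {..<d} \<and> leader \<pi> ?A \<in> ?A - ?C}"
  note cx = cand_good[OF x] and cy = cand_good[OF y]
  have finP: "finite {\<pi>. \<pi> permutes {..<d}}" by (rule finite_permutations) simp
  have Kpos: "real (card K) > 0" using K by (auto simp: card_gt_0_iff)
  have "{\<pi>. \<pi> permutes {..<d} \<and> leader \<pi> (cand x) \<noteq> leader \<pi> (cand y)} \<subseteq> ?P"
  proof safe
    fix \<pi> assume \<pi>: "\<pi> permutes {..<d}" and ne: "leader \<pi> (cand x) \<noteq> leader \<pi> (cand y)"
    have "leader \<pi> ?A \<in> ?A" using cx cy by (intro leader_mem) auto
    then show "leader \<pi> ?A \<in> cand x" if "leader \<pi> ?A \<notin> cand y" using that by blast
    show False if "leader \<pi> ?A \<in> cand x" "leader \<pi> ?A \<in> cand y"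
      using leader_Un[OF permutes_inj[OF \<pi>] cx(2) cy(2)] that ne by blast
  qed
  moreover have "finite ?P" by (rule finite_subset[OF _ finP]) auto
  ultimately have "card {\<pi>. \<pi> permutes {..<d} \<and> leader \<pi> (cand x) \<noteq> leader \<pi> (cand y)} \<le> card ?P"
    by (rule card_mono[rotated])
  moreover have "real (card ?P) \<le> 2 * \<epsilon> * fact d"
  proof -
    have "?A \<subseteq> {..<d}" using cx(1) cy(1) by (rule Un_least)
    then have "card ?P * card ?A = card (?A - ?C) * fact (card {..<d})"
      by (rule card_leader_in[OF finite_lessThan _ Diff_subset])
    then have "real (card ?P * card ?A) = real (card (?A - ?C) * fact d)"
      by (simp only: card_lessThan)
    then have eq: "real (card ?P) * real (card ?A) = real (card (?A - ?C)) * fact d"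
      by (simp only: of_nat_mult of_nat_fact)
    have "real (card (?A - ?C)) \<le> 2 * \<epsilon> * card K"
    proof -
      have "card (?A - ?C) + card ?C = card ?A"
      proof -
        have "?C \<subseteq> ?A" by blast
        then have "card ?C \<le> card ?A" "card (?A - ?C) = card ?A - card ?C"
          using cx cy by (simp_all add: card_mono card_Diff_subset)
        then show ?thesis by simp
      qed
      moreover have "card ?A + card ?C = card K + card K"
        using card_Un_Int[OF cx(2) cy(2)] cx cy by simp
      ultimately have "real (card (?A - ?C)) + 2 * real (card ?C) = 2 * real (card K)" by linarith
      then show ?thesis using card_cand_Int[OF x s R] by (simp add: algebra_simps)
    qed
    then have "real (card ?P) * real (card ?A) \<le> (2 * \<epsilon> * card K) * fact d"
      unfolding eq by (intro mult_right_mono) auto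
    moreover have "real (card ?P) * real (card K) \<le> real (card ?P) * real (card ?A)"
      using card_mono[of ?A "cand x"] cx cy by (intro mult_left_mono) auto
    ultimately have "real (card ?P) * real (card K) \<le> (2 * \<epsilon> * fact d) * real (card K)"
      by (simp add: algebra_simps)
    then show ?thesis using Kpos by (simp add: mult_le_cancel_right)
  qed
  ultimately show ?thesis by linarith
qed

end

section \<open>Clusters of a random order\<close>

context folner_action
begin

text \<open>
  Exceptional points form clusters of their own, so that they cost nothing in \<open>card_moved\<close>.
\<close>

definition cluster :: "(nat \<Rightarrow> nat) \<Rightarrow> nat \<Rightarrow> nat" where
  "cluster \<pi> x = (if x < d \<and> x \<notin> X then leader \<pi> (cand x) else x)"

text \<open>
  The value of the move \<open>s\<close> at \<open>x\<close> can be recovered from the clusters.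
\<close>

definition linked :: "(nat \<Rightarrow> nat) \<Rightarrow> 'g \<Rightarrow> nat \<Rightarrow> bool" where
  "linked c s x \<longleftrightarrow> x < d \<and> x \<notin> X \<and> (\<exists>y. y < d \<and> y \<notin> X \<and> R s y x \<and> c y = c x)"

text \<open>
  A point outside \<open>X\<close> is one of its \<open>card K\<close> equally likely candidates, because \<open>0 \<in> K\<close>.
\<close>

lemma card_moved:
  assumes x: "x < d"
  shows "real (card {\<pi>. \<pi> permutes {..<d} \<and> cluster \<pi> x \<noteq> x}) \<le> (1 - 1 / card K) * fact d"
proof (cases "x \<in> X")
  case True
  have "card K \<ge> 1" using K by (simp add: Suc_le_eq card_gt_0_iff) blast
  then show ?thesis using True by (simp add: cluster_def)
next
  case False
  note good = cand_good[OF x False]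
  let ?P = "{\<pi>. \<pi> permutes {..<d} \<and> leader \<pi> (cand x) \<in> cand x - {x}}"
  have "leader \<pi> (cand x) \<in> cand x" for \<pi> using leader_mem good by blast
  then have "{\<pi>. \<pi> permutes {..<d} \<and> cluster \<pi> x \<noteq> x} = ?P"
    using x False by (simp add: cluster_def)
  moreover have "card ?P * card (cand x) = card (cand x - {x}) * fact (card {..<d})"
    by (rule card_leader_in[OF finite_lessThan good(1) Diff_subset])
  then have "real (card ?P * card (cand x)) = real (card (cand x - {x}) * fact d)"
    by (simp only: card_lessThan)
  moreover have "real (card (cand x - {x})) = real (card K) - 1"
  proof -
    have "card K \<ge> 1" using K by (simp add: Suc_le_eq card_gt_0_iff) blast
    then show ?thesis using good by (simp add: of_nat_diff)
  qed
  ultimately have "real (card {\<pi>. \<pi> permutes {..<d} \<and> cluster \<pi> x \<noteq> x}) * card K = (real (card K) - 1) * fact d"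
    by (simp only: of_nat_mult of_nat_fact good(3))
  moreover have "real (card K) > 0" using K by (auto simp: card_gt_0_iff)
  ultimately show ?thesis by (simp add: field_simps)
qed

lemma card_unlinked_good:
  assumes x: "x < d" "x \<notin> X" and s: "s \<in> E" and y: "act s x \<notin> X"
  shows "real (card {\<pi>. \<pi> permutes {..<d} \<and> \<not> linked (cluster \<pi>) s x}) \<le> 2 * \<epsilon> * fact d"
proof -
  have R: "R s (act s x) x" using R_act x s E by blast
  then have yd: "act s x < d" using R_less by blast
  have finP: "finite {\<pi>. \<pi> permutes {..<d} \<and> leader \<pi> (cand x) \<noteq> leader \<pi> (cand (act s x))}"
    by (rule finite_subset[OF _ finite_permutations[of "{..<d}"]]) auto
  have "{\<pi>. \<pi> permutes {..<d} \<and> \<not> linked (cluster \<pi>) s x}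
    \<subseteq> {\<pi>. \<pi> permutes {..<d} \<and> leader \<pi> (cand x) \<noteq> leader \<pi> (cand (act s x))}"
    using x y R yd by (auto simp: linked_def cluster_def)
  then have "card {\<pi>. \<pi> permutes {..<d} \<and> \<not> linked (cluster \<pi>) s x}
    \<le> card {\<pi>. \<pi> permutes {..<d} \<and> leader \<pi> (cand x) \<noteq> leader \<pi> (cand (act s x))}"
    by (rule card_mono[OF finP])
  then show ?thesis using card_leader_differs[OF x yd y s R] by linarith
qed

text \<open>
  The estimate of \<open>card_unlinked_good\<close> is not available if \<open>x\<close> or \<open>s \<cdot> x\<close> lies in \<open>X\<close>. As \<open>s\<close> acts
  injectively, this concerns at most \<open>2 * card X\<close> points.
\<close>

lemma sum_card_unlinked:
  assumes s: "s \<in> E"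
  shows "(\<Sum>x<d. real (card {\<pi>. \<pi> permutes {..<d} \<and> \<not> linked (cluster \<pi>) s x}))
    \<le> (2 * card X + 2 * \<epsilon> * d) * fact d"
proof -
  define Y where "Y = {x. x < d \<and> x \<notin> X \<and> act s x \<in> X}"
  have finX: "finite X" using X finite_subset by blast
  have "inj_on (act s) Y"
  proof (rule inj_onI)
    fix x x' assume "x \<in> Y" "x' \<in> Y" "act s x = act s x'"
    then have "R s (act s x) x" "R s (act s x) x'"
      using R_act[of x s] R_act[of x' s] s E by (auto simp: Y_def)
    then show "x = x'" using R_inj s E by blast
  qed
  then have "card Y \<le> card X" using finX by (intro card_inj_on_le) (auto simp: Y_def)
  have finY: "finite Y" by (simp add: Y_def)
  have le_fact: "real (card {\<pi>. \<pi> permutes {..<d} \<and> Q \<pi>}) \<le> fact d" for Q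
  proof -
    have "card {\<pi>. \<pi> permutes {..<d} \<and> Q \<pi>} \<le> card {\<pi>. \<pi> permutes {..<d}}"
      by (rule card_mono[OF finite_permutations]) auto
    also have "\<dots> = fact d" by (rule card_permutations) simp_all
    finally have "real (card {\<pi>. \<pi> permutes {..<d} \<and> Q \<pi>}) \<le> real (fact d)" by (simp only: of_nat_le_iff)
    then show ?thesis by simp
  qed
  have "(\<Sum>x<d. real (card {\<pi>. \<pi> permutes {..<d} \<and> \<not> linked (cluster \<pi>) s x}))
    \<le> (\<Sum>x<d. (of_bool (x \<in> X \<union> Y) + 2 * \<epsilon>) * fact d)"
  proof (rule sum_mono)
    fix x assume "x \<in> {..<d}"
    show "real (card {\<pi>. \<pi> permutes {..<d} \<and> \<not> linked (cluster \<pi>) s x})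
        \<le> (of_bool (x \<in> X \<union> Y) + 2 * \<epsilon>) * fact d"
    proof (cases "x \<in> X \<union> Y")
      case True
      then have one: "of_bool (x \<in> X \<union> Y) = (1 :: real)" by (simp only: of_bool_eq)
      have "fact d \<le> (1 + 2 * \<epsilon>) * fact d" using \<epsilon> by (simp add: distrib_right)
      then show ?thesis unfolding one by (rule order_trans[OF le_fact])
    next
      case False
      then have x: "x < d" "x \<notin> X" "act s x \<notin> X" using \<open>x \<in> {..<d}\<close> by (auto simp: Y_def)
      have zero: "of_bool (x \<in> X \<union> Y) = (0 :: real)" using False by (simp only: of_bool_eq)
      show ?thesis unfolding zero add_0 using card_unlinked_good[OF x(1,2) s x(3)] .
    qed
  qed
  also have "\<dots> = (real (card (X \<union> Y)) + 2 * \<epsilon> * d) * fact d"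
  proof -
    have "X \<union> Y \<subseteq> {..<d}" using X by (auto simp: Y_def)
    then have "(\<Sum>x<d. of_bool (x \<in> X \<union> Y)) = (\<Sum>x\<in>X \<union> Y. 1 :: real)"
      by (intro sum.mono_neutral_cong_right) auto
    then have "(\<Sum>x<d. of_bool (x \<in> X \<union> Y) + 2 * \<epsilon>) = real (card (X \<union> Y)) + 2 * \<epsilon> * d"
      unfolding sum.distrib by simp
    then show ?thesis by (simp only: flip: sum_distrib_right)
  qed
  also have "\<dots> \<le> (2 * card X + 2 * \<epsilon> * d) * fact d"
  proof -
    have "card (X \<union> Y) \<le> card X + card Y" by (rule card_Un_le)
    then have "real (card (X \<union> Y)) \<le> 2 * card X" using \<open>card Y \<le> card X\<close> by simp
    then show ?thesis by (intro mult_right_mono) auto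
  qed
  finally show ?thesis .
qed

text \<open>
  An upper bound for the expected number of values in \<open>{..<d}\<close> that have to be stored.
\<close>

definition cost_bound :: real where
  "cost_bound = d * (1 - 1 / card K) + card E * (2 * card X + 2 * \<epsilon> * d)"

lemma exists_cheap_order:
  obtains \<pi> where
    "real (card {x\<in>{..<d}. cluster \<pi> x \<noteq> x})
       + (\<Sum>s\<in>E. real (card {x\<in>{..<d}. \<not> linked (cluster \<pi>) s x})) \<le> cost_bound"
proof -
  let ?P = "{\<pi>. \<pi> permutes {..<d}}"
  let ?f = "\<lambda>\<pi>. real (card {x\<in>{..<d}. cluster \<pi> x \<noteq> x})
       + (\<Sum>s\<in>E. real (card {x\<in>{..<d}. \<not> linked (cluster \<pi>) s x}))"
  have finP: "finite ?P" by (rule finite_permutations) simp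
  have cardP: "card ?P = fact d" by (rule card_permutations) simp_all
  have swap: "(\<Sum>\<pi>\<in>?P. real (card {x\<in>{..<d}. Q \<pi> x})) = (\<Sum>x<d. real (card {\<pi>. \<pi> permutes {..<d} \<and> Q \<pi> x}))" for Q
    using sum_card_swap[OF finP finite_lessThan[of d], of Q] by (simp flip: of_nat_sum)
  have "(\<Sum>\<pi>\<in>?P. ?f \<pi>) = (\<Sum>\<pi>\<in>?P. real (card {x\<in>{..<d}. cluster \<pi> x \<noteq> x}))
      + (\<Sum>s\<in>E. \<Sum>\<pi>\<in>?P. real (card {x\<in>{..<d}. \<not> linked (cluster \<pi>) s x}))"
    unfolding sum.distrib by (subst sum.swap[of _ E]) simp
  also have "\<dots> \<le> d * (1 - 1 / card K) * fact d + (\<Sum>s\<in>E. (2 * card X + 2 * \<epsilon> * d) * fact d)"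
    unfolding swap
  proof (rule add_mono)
    have "(\<Sum>x<d. real (card {\<pi>. \<pi> permutes {..<d} \<and> cluster \<pi> x \<noteq> x})) \<le> (\<Sum>x<d. (1 - 1 / card K) * fact d)"
      using card_moved by (intro sum_mono) simp
    then show "(\<Sum>x<d. real (card {\<pi>. \<pi> permutes {..<d} \<and> cluster \<pi> x \<noteq> x})) \<le> d * (1 - 1 / card K) * fact d"
      by simp
    show "(\<Sum>s\<in>E. \<Sum>x<d. real (card {\<pi>. \<pi> permutes {..<d} \<and> \<not> linked (cluster \<pi>) s x}))
        \<le> (\<Sum>s\<in>E. (2 * card X + 2 * \<epsilon> * d) * fact d)"
      by (intro sum_mono sum_card_unlinked)
  qed
  also have "\<dots> = card ?P * cost_bound"
    unfolding cardP cost_bound_def by (simp add: algebra_simps)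
  finally have "(\<Sum>\<pi>\<in>?P. ?f \<pi>) \<le> card ?P * cost_bound" .
  moreover have "?P \<noteq> {}" using permutes_id[of "{..<d}"] by blast
  ultimately have "\<exists>\<pi>\<in>?P. ?f \<pi> \<le> cost_bound" using exists_le_average[OF finP] by blast
  then show thesis using that by blast
qed

end

section \<open>Encoding almost actions\<close>

text \<open>
  A code consists of two functions. The first, \<open>w\<close>, holds the cluster of \<open>x\<close> at \<open>(None, x)\<close>; at
  \<open>(Some s, x)\<close> it holds the image of \<open>x\<close> under \<open>s\<close>, with \<open>d\<close> for an undefined image and \<open>Suc d\<close> for an
  image that is to be found from the clusters. The second, \<open>a\<close>, holds the position \<open>\<kappa> x \<in> K\<close> of \<open>x\<close> in
  its cluster, with \<open>None\<close> for exceptional points.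
\<close>

definition decode :: "nat \<Rightarrow> ('g::group_add option \<times> nat \<Rightarrow> nat) \<Rightarrow> (nat \<Rightarrow> 'g option)
    \<Rightarrow> 'g \<Rightarrow> nat \<Rightarrow> nat \<Rightarrow> bool" where
  "decode d w a s i j \<longleftrightarrow> j < d \<and>
     (if w (Some s, j) = Suc d
      then \<exists>k. a j = Some k \<and> i < d \<and> a i = Some (s + k) \<and> w (None, i) = w (None, j)
      else i < d \<and> w (Some s, j) = i)"

text \<open>
  The first component of a code deviates at few arguments from the default, which is the cluster \<open>x\<close>
  at \<open>(None, x)\<close> and \<open>Suc d\<close> at \<open>(Some s, x)\<close>. Only this component takes more than a bounded
  number of values.
\<close>

definition code_set :: "nat \<Rightarrow> 'g set \<Rightarrow> 'g set \<Rightarrow> real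
    \<Rightarrow> (('g::group_add option \<times> nat \<Rightarrow> nat) \<times> (nat \<Rightarrow> 'g option)) set" where
  "code_set d E K M = {w \<in> insert None (Some ` E) \<times> {..<d} \<rightarrow>\<^sub>E {..Suc d}.
      real (card {p \<in> insert None (Some ` E) \<times> {..<d}.
        w p \<noteq> (case p of (None, x) \<Rightarrow> x | (Some s, x) \<Rightarrow> Suc d)}) \<le> M}
    \<times> ({..<d} \<rightarrow>\<^sub>E insert None (Some ` K))"

lemma code_set_mono:
  assumes "M \<le> M'"
  shows "code_set d E K M \<subseteq> code_set d E K M'"
  unfolding code_set_def
  by (intro Sigma_mono Collect_mono order_refl impI conjI; elim conjE; (assumption | rule order_trans[OF _ assms]))

context folner_action
begin

text \<open>
  Let \<open>y = s \<cdot> j\<close> with \<open>c y = c j\<close>. Both \<open>- \<kappa> y + s\<close> and \<open>- \<kappa> j\<close> move \<open>j\<close> to this common center, so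
  they are equal by freeness, that is \<open>\<kappa> y = s + \<kappa> j\<close>. A point with this position and this
  center must be \<open>y\<close>, since \<open>- \<kappa> y\<close> acts injectively.
\<close>

lemma linked_decode:
  assumes c: "\<And>x. x < d \<Longrightarrow> x \<notin> X \<Longrightarrow> \<kappa> x \<in> K \<and> c x = act (- \<kappa> x) x"
    and s: "s \<in> E" and linked: "linked c s j"
  shows "R s i j \<longleftrightarrow> i < d \<and> i \<notin> X \<and> \<kappa> i = s + \<kappa> j \<and> c i = c j"
proof -
  obtain y where j: "j < d" "j \<notin> X" and y: "y < d" "y \<notin> X" "R s y j" "c y = c j"
    using linked by (auto simp: linked_def)
  have sS: "s \<in> S" using s E by blast
  have "act (- \<kappa> y + s) j = act (- \<kappa> j + 0) j"
    using cand_step[OF j s y(3)] c[OF y(1,2)] c[OF j] y(4) by simp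
  then have "- \<kappa> y + s = - \<kappa> j + 0"
    using c[OF y(1,2)] c[OF j] s by (intro act_inj[OF j KE KE KE2]) auto
  then have "\<kappa> y + (- \<kappa> y + s) = \<kappa> y + - \<kappa> j" by simp
  then have ky: "\<kappa> y = s + \<kappa> j" by (simp add: eq_diff_eq)
  show ?thesis
  proof
    assume "R s i j"
    then have "i = y" using R_func[OF sS] y(3) by blast
    then show "i < d \<and> i \<notin> X \<and> \<kappa> i = s + \<kappa> j \<and> c i = c j" using y ky by simp
  next
    assume i: "i < d \<and> i \<notin> X \<and> \<kappa> i = s + \<kappa> j \<and> c i = c j"
    have "R (- \<kappa> y) (c y) y" using R_act[OF y(1,2)] uminus_K c[OF y(1,2)] by metis
    moreover have "R (- \<kappa> y) (c y) i"
      using R_act[of i "- \<kappa> i"] uminus_K c[of i] i ky y(4) by metis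
    ultimately have "y = i" using R_inj[OF uminus_K] c[OF y(1,2)] by blast
    then show "R s i j" using y(3) by simp
  qed
qed

lemma encode:
  obtains w a where "(w, a) \<in> code_set d E K cost_bound" "\<And>s i j. s \<in> E \<Longrightarrow> R s i j \<longleftrightarrow> decode d w a s i j"
proof -
  obtain \<pi> where cost: "real (card {x\<in>{..<d}. cluster \<pi> x \<noteq> x})
       + (\<Sum>s\<in>E. real (card {x\<in>{..<d}. \<not> linked (cluster \<pi>) s x})) \<le> cost_bound"
    using exists_cheap_order by blast
  define c where "c = cluster \<pi>"
  have "\<exists>k. k \<in> K \<and> c x = act (- k) x" if "x < d" "x \<notin> X" for x
  proof -
    have "leader \<pi> (cand x) \<in> cand x" using leader_mem cand_good[OF that] by blast
    then show ?thesis using that by (auto simp: c_def cluster_def cand_def)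
  qed
  then obtain \<kappa> where \<kappa>: "\<And>x. x < d \<Longrightarrow> x \<notin> X \<Longrightarrow> \<kappa> x \<in> K \<and> c x = act (- \<kappa> x) x"
    by metis
  have c_less: "c x < d" if "x < d" for x
  proof (cases "x \<in> X")
    case True
    then show ?thesis using that by (simp add: c_def cluster_def)
  next
    case False
    then show ?thesis using \<kappa>[OF that False] R_less[OF R_act[OF that False uminus_K]] by metis
  qed
  let ?I = "insert None (Some ` E) \<times> {..<d}"
  define v where "v p = (case p of (None, x) \<Rightarrow> c x
    | (Some s, x) \<Rightarrow> if linked c s x then Suc d else if \<exists>i. R s i x then act s x else d)" for p
  define w where "w = restrict v ?I"
  define a where "a = restrict (\<lambda>x. if x \<in> X then None else Some (\<kappa> x)) {..<d}"
  have v_less: "v p \<le> Suc d" if p: "p \<in> ?I" for p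
  proof -
    have "act s x < d" if "s \<in> E" "R s i x" for s i x
      using that act_eq R_less E by blast
    then show ?thesis using p c_less by (auto simp: v_def less_imp_le le_SucI)
  qed
  have "(w, a) \<in> code_set d E K cost_bound"
    unfolding code_set_def
  proof (intro SigmaI CollectI conjI)
    show "w \<in> ?I \<rightarrow>\<^sub>E {..Suc d}" unfolding w_def using v_less by (intro restrict_PiE_iff[THEN iffD2]) auto
    show "a \<in> {..<d} \<rightarrow>\<^sub>E insert None (Some ` K)"
      unfolding a_def using \<kappa> by (intro restrict_PiE_iff[THEN iffD2]) auto
    let ?D = "{p \<in> ?I. w p \<noteq> (case p of (None, x) \<Rightarrow> x | (Some s, x) \<Rightarrow> Suc d)}"
    have sub: "?D \<subseteq> Pair None ` {x\<in>{..<d}. c x \<noteq> x} \<union> (\<Union>s\<in>E. Pair (Some s) ` {x\<in>{..<d}. \<not> linked c s x})"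
      by (auto simp: w_def v_def split: if_splits)
    have "card ?D \<le> card (Pair None ` {x\<in>{..<d}. c x \<noteq> x} \<union> (\<Union>s\<in>E. Pair (Some s) ` {x\<in>{..<d}. \<not> linked c s x}))"
      using E by (intro card_mono[OF _ sub]) auto
    also have "\<dots> \<le> card (Pair (None :: 'g option) ` {x\<in>{..<d}. c x \<noteq> x})
        + card (\<Union>s\<in>E. Pair (Some s) ` {x\<in>{..<d}. \<not> linked c s x})"
      by (rule card_Un_le)
    also have "\<dots> \<le> card {x\<in>{..<d}. c x \<noteq> x} + (\<Sum>s\<in>E. card {x\<in>{..<d}. \<not> linked c s x})"
    proof (rule add_mono)
      show "card (Pair (None :: 'g option) ` {x\<in>{..<d}. c x \<noteq> x}) \<le> card {x\<in>{..<d}. c x \<noteq> x}"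
        by (rule card_image_le) simp
      have "card (\<Union>s\<in>E. Pair (Some s) ` {x\<in>{..<d}. \<not> linked c s x})
          \<le> (\<Sum>s\<in>E. card (Pair (Some s) ` {x\<in>{..<d}. \<not> linked c s x}))"
        using E(1) by (rule card_UN_le)
      also have "\<dots> \<le> (\<Sum>s\<in>E. card {x\<in>{..<d}. \<not> linked c s x})"
        by (intro sum_mono card_image_le) simp
      finally show "card (\<Union>s\<in>E. Pair (Some s) ` {x\<in>{..<d}. \<not> linked c s x})
          \<le> (\<Sum>s\<in>E. card {x\<in>{..<d}. \<not> linked c s x})" .
    qed
    finally have "real (card ?D)
        \<le> real (card {x\<in>{..<d}. c x \<noteq> x} + (\<Sum>s\<in>E. card {x\<in>{..<d}. \<not> linked c s x}))"
      by (simp only: of_nat_le_iff)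
    also have "\<dots> \<le> cost_bound" using cost by (simp add: c_def)
    finally show "real (card ?D) \<le> cost_bound" .
  qed
  moreover have "R s i j \<longleftrightarrow> decode d w a s i j" if s: "s \<in> E" for s i j
  proof (cases "j < d")
    case False
    then show ?thesis using R_less by (auto simp: decode_def)
  next
    case j: True
    have sS: "s \<in> S" using s E by blast
    have wj: "w (Some s, j) = v (Some s, j)" using s j by (simp add: w_def)
    show ?thesis
    proof (cases "linked c s j")
      case True
      then have jX: "j \<notin> X" by (simp add: linked_def)
      have "decode d w a s i j \<longleftrightarrow> i < d \<and> i \<notin> X \<and> \<kappa> i = s + \<kappa> j \<and> c i = c j"
        using True j jX s unfolding decode_def wj by (auto simp: w_def a_def v_def)
      then show ?thesis using linked_decode[of \<kappa> c, OF \<kappa> s True] by blast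
    next
      case False
      have actd: "act s j = i" "i < d" if "R s i j" for i
        using act_eq[OF sS that] R_less[OF that] by auto
      have less: "act s j \<noteq> Suc d" if "R s i j" for i
        using actd[OF that] by auto
      have "w (Some s, j) = (if \<exists>i. R s i j then act s j else d)" "w (Some s, j) \<noteq> Suc d"
        unfolding wj using False less by (auto simp: v_def)
      then have "decode d w a s i j \<longleftrightarrow> i < d \<and> (if \<exists>i. R s i j then act s j else d) = i"
        using j by (simp add: decode_def)
      also have "\<dots> \<longleftrightarrow> R s i j" using actd by (auto split: if_splits)
      finally show ?thesis by simp
    qed
  qed
  ultimately show thesis by (rule that)
qed

end

text \<open>
  Choose the set of arguments where the function deviates from \<open>f\<close>, and the values there.
\<close>

lemma card_sparse_functions:
  fixes f :: "'i \<Rightarrow> 'a" and M :: real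
  assumes I: "finite I" and Y: "finite Y" "Y \<noteq> {}"
  shows "real (card {w \<in> I \<rightarrow>\<^sub>E Y. real (card {p\<in>I. w p \<noteq> f p}) \<le> M}) \<le> 2 ^ card I * real (card Y) powr M"
proof (cases "M < 0")
  case True
  have "\<not> real n \<le> M" for n :: nat
    using True of_nat_0_le_iff[of n, where 'a = real] by linarith
  then have "{w \<in> I \<rightarrow>\<^sub>E Y. real (card {p\<in>I. w p \<noteq> f p}) \<le> M} = {}" by blast
  then show ?thesis by (simp only: card.empty) simp
next
  case False
  let ?W = "{w \<in> I \<rightarrow>\<^sub>E Y. real (card {p\<in>I. w p \<noteq> f p}) \<le> M}"
  let ?\<D> = "{D \<in> Pow I. real (card D) \<le> M}"
  let ?g = "\<lambda>w. ({p\<in>I. w p \<noteq> f p}, restrict w {p\<in>I. w p \<noteq> f p})"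
  have fin\<D>: "finite ?\<D>" using I by simp
  have finD: "finite (D \<rightarrow>\<^sub>E Y)" if "D \<in> ?\<D>" for D
    using that I Y by (intro finite_PiE) (auto intro: finite_subset)
  have "inj_on ?g ?W"
  proof (rule inj_onI)
    fix w w' assume w: "w \<in> ?W" and w': "w' \<in> ?W" and eq: "?g w = ?g w'"
    show "w = w'"
    proof
      fix p
      show "w p = w' p"
      proof (cases "p \<in> I")
        case True
        have D: "{p\<in>I. w p \<noteq> f p} = {p\<in>I. w' p \<noteq> f p}" using eq by simp
        show ?thesis
        proof (cases "w p = f p")
          case True
          then have "p \<notin> {p\<in>I. w p \<noteq> f p}" by simp
          then have "w' p = f p" unfolding D using \<open>p \<in> I\<close> by simp
          then show ?thesis using True by simp
        next
          case False
          then have p: "p \<in> {p\<in>I. w p \<noteq> f p}" using \<open>p \<in> I\<close> by simp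
          have "snd (?g w) = snd (?g w')" using eq by (rule arg_cong)
          then have "restrict w {p\<in>I. w p \<noteq> f p} = restrict w' {p\<in>I. w' p \<noteq> f p}"
            by (simp only: snd_conv)
          then have "restrict w {p\<in>I. w p \<noteq> f p} p = restrict w' {p\<in>I. w p \<noteq> f p} p"
            unfolding D by (rule fun_cong)
          then show ?thesis unfolding restrict_apply'[OF p] .
        qed
      next
        case False
        have "w p = undefined" "w' p = undefined"
          using w w' False by (auto simp: PiE_iff extensional_def)
        then show ?thesis by simp
      qed
    qed
  qed
  moreover have "?g ` ?W \<subseteq> Sigma ?\<D> (\<lambda>D. D \<rightarrow>\<^sub>E Y)"
  proof (rule image_subsetI)
    fix w assume "w \<in> ?W"
    then have "\<And>p. p \<in> I \<Longrightarrow> w p \<in> Y" "real (card {p\<in>I. w p \<noteq> f p}) \<le> M"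
      by (auto simp: PiE_iff)
    then show "?g w \<in> Sigma ?\<D> (\<lambda>D. D \<rightarrow>\<^sub>E Y)"
      by (intro SigmaI CollectI conjI restrict_PiE_iff[THEN iffD2]) auto
  qed
  moreover have "finite (Sigma ?\<D> (\<lambda>D. D \<rightarrow>\<^sub>E Y))"
    using fin\<D> finD by (rule finite_SigmaI)
  ultimately have "card ?W \<le> card (Sigma ?\<D> (\<lambda>D. D \<rightarrow>\<^sub>E Y))"
    by (rule card_inj_on_le)
  also have "\<dots> = (\<Sum>D\<in>?\<D>. card Y ^ card D)"
  proof -
    have "card (D \<rightarrow>\<^sub>E Y) = card Y ^ card D" if "D \<in> ?\<D>" for D
      using that I by (subst card_PiE) (auto intro: finite_subset)
    then show ?thesis using fin\<D> finD by (subst card_SigmaI) auto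
  qed
  finally have "real (card ?W) \<le> (\<Sum>D\<in>?\<D>. real (card Y) ^ card D)"
    by (simp flip: of_nat_power of_nat_sum)
  also have "\<dots> \<le> (\<Sum>D\<in>?\<D>. real (card Y) powr M)"
  proof (rule sum_mono)
    fix D assume D: "D \<in> ?\<D>"
    have Y1: "real (card Y) \<ge> 1" using Y by (simp add: Suc_le_eq card_gt_0_iff)
    then have "real (card Y) ^ card D = real (card Y) powr real (card D)"
      by (simp add: powr_realpow)
    also have "\<dots> \<le> real (card Y) powr M" using Y1 D by (intro powr_mono) auto
    finally show "real (card Y) ^ card D \<le> real (card Y) powr M" .
  qed
  also have "\<dots> = real (card ?\<D>) * real (card Y) powr M" by simp
  also have "\<dots> \<le> real (card (Pow I)) * real (card Y) powr M"
    using I by (intro mult_right_mono) (auto intro: card_mono)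
  finally show ?thesis using I by (simp add: card_Pow)
qed

lemma card_code_set:
  fixes E K :: "'g::group_add set"
  assumes E: "finite E" and K: "finite K"
  shows "finite (code_set d E K M)"
    and "real (card (code_set d E K M)) \<le> 2 ^ ((card E + 1) * d) * (real d + 2) powr M * (real (card K) + 1) ^ d"
proof -
  let ?I = "insert None (Some ` E) \<times> {..<d}"
  let ?W = "{w \<in> ?I \<rightarrow>\<^sub>E {..Suc d}. real (card {p \<in> ?I.
        w p \<noteq> (case p of (None, x) \<Rightarrow> x | (Some s, x) \<Rightarrow> Suc d)}) \<le> M}"
  let ?A = "{..<d} \<rightarrow>\<^sub>E insert None (Some ` K)"
  have I: "finite ?I" using E by simp
  have cardI: "card ?I = (card E + 1) * d"
    using E by (simp add: card_cartesian_product card_image)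
  have "finite (?I \<rightarrow>\<^sub>E {..Suc d})" using I by (intro finite_PiE) auto
  then have finW: "finite ?W" by (rule rev_finite_subset) blast
  have finA: "finite ?A" using K by (intro finite_PiE) auto
  show "finite (code_set d E K M)" unfolding code_set_def using finW finA by (rule finite_cartesian_product)
  have "real (card ?W) \<le> 2 ^ card ?I * real (card {..Suc d}) powr M"
    by (rule card_sparse_functions[OF I]) auto
  then have W: "real (card ?W) \<le> 2 ^ ((card E + 1) * d) * (real d + 2) powr M"
    unfolding cardI by (simp add: add.commute)
  have "card ?A = (card K + 1) ^ d" using K by (simp add: card_PiE card_image)
  then have A: "real (card ?A) = (real (card K) + 1) ^ d" by (simp add: add.commute)
  have "real (card (code_set d E K M)) = real (card ?W) * real (card ?A)"
    unfolding code_set_def by (simp only: card_cartesian_product of_nat_mult)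
  also have "\<dots> \<le> (2 ^ ((card E + 1) * d) * (real d + 2) powr M) * (real (card K) + 1) ^ d"
    unfolding A by (intro mult_right_mono[OF W]) simp
  finally show "real (card (code_set d E K M)) \<le> 2 ^ ((card E + 1) * d) * (real d + 2) powr M * (real (card K) + 1) ^ d" .
qed

section \<open>Sofic approximations as almost actions\<close>

definition mat_rel :: "nat \<Rightarrow> ('g::group_add group_algebra \<Rightarrow> complex mat) \<Rightarrow> 'g \<Rightarrow> nat \<Rightarrow> nat \<Rightarrow> bool" where
  "mat_rel d \<phi> g i j \<longleftrightarrow> i < d \<and> j < d \<and> \<phi> (grp_elem g) $$ (i, j) = 1"

lemma SA_grp_elem:
  fixes S :: "'g::group_add set"
  assumes \<phi>: "\<phi> \<in> SA (grp_elem ` S) 2 \<delta> d"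
  shows "g \<in> S \<Longrightarrow> \<phi> (grp_elem g) \<in> partial_perm_mats d"
    and "g \<in> S \<Longrightarrow> h \<in> S \<Longrightarrow> \<phi> (grp_elem (g + h)) \<in> partial_perm_mats d"
    and "g \<in> S \<Longrightarrow> h \<in> S \<Longrightarrow>
      norm2 (\<phi> (grp_elem (g + h)) - \<phi> (grp_elem g) * \<phi> (grp_elem h)) < \<delta>"
    and "g \<in> S \<Longrightarrow> cmod (ntr (\<phi> (grp_elem g)) - (if g = 0 then 1 else 0)) < \<delta>"
proof -
  let ?F = "grp_elem ` S \<union> ga_star ` grp_elem ` S"
  have P: "prod_list ss \<in> products_upto ?F 2" if "set ss \<subseteq> ?F" "length ss = 1 \<or> length ss = 2" for ss
    using that by (force simp: products_upto_def products_def)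
  have one: "grp_elem g \<in> products_upto ?F 2" if "g \<in> S" for g
    using P[of "[grp_elem g]"] that by simp
  have two: "grp_elem (g + h) \<in> products_upto ?F 2" if "g \<in> S" "h \<in> S" for g h
    using P[of "[grp_elem g, grp_elem h]"] that by (simp add: grp_elem_mult)
  have perm: "\<phi> ` products_upto ?F 2 \<subseteq> partial_perm_mats d"
    and norm: "\<And>ss. 1 \<le> length ss \<Longrightarrow> length ss \<le> 2 \<Longrightarrow> set ss \<subseteq> ?F \<Longrightarrow>
           norm2 (\<phi> (prod_list ss) - foldr (*) (map \<phi> ss) (1\<^sub>m d)) < \<delta>"
    and trace: "\<And>s. s \<in> products_upto ?F 2 \<Longrightarrow> cmod (ntr (\<phi> s) - ga_trace s) < \<delta>"
    using \<phi> unfolding SA_def by blast+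
  show perm1: "\<phi> (grp_elem g) \<in> partial_perm_mats d" if "g \<in> S" for g
    using perm one[OF that] by blast
  show "\<phi> (grp_elem (g + h)) \<in> partial_perm_mats d" if "g \<in> S" "h \<in> S" for g h
    using perm two[OF that] by blast
  show "norm2 (\<phi> (grp_elem (g + h)) - \<phi> (grp_elem g) * \<phi> (grp_elem h)) < \<delta>" if "g \<in> S" "h \<in> S" for g h
    using norm[of "[grp_elem g, grp_elem h]"] that partial_perm_matsD(1)[OF perm1[OF that(2)]]
    by (simp add: grp_elem_mult)
  show "cmod (ntr (\<phi> (grp_elem g)) - (if g = 0 then 1 else 0)) < \<delta>" if "g \<in> S" for g
    using trace[OF one[OF that]] unfolding ga_trace_grp_elem .
qed

lemma ntr_partial_perm:
  assumes V: "V \<in> partial_perm_mats d"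
  shows "ntr V = of_real (real (card {j\<in>{..<d}. V $$ (j, j) = 1}) / real d)"
proof -
  note V = partial_perm_matsD[OF V]
  have "mtrace V = (\<Sum>j<d. if V $$ (j, j) = 1 then 1 else 0)"
    unfolding mtrace_def using V(1) V(2) by (intro sum.cong) force+
  also have "\<dots> = of_nat (card {j\<in>{..<d}. V $$ (j, j) = 1})"
    by (simp add: sum.If_cases Int_def)
  finally show ?thesis using V(1) by (simp add: ntr_def)
qed

text \<open>
  The exceptional points are those that the identity does not fix, those that another element of \<open>S\<close>
  fixes, and the columns where \<open>\<phi> (g + h)\<close> differs from \<open>\<phi> g * \<phi> h\<close>. The trace condition bounds the
  first two kinds, since the trace of a partial permutation matrix counts its fixed points, and the norm
  condition bounds the third.
\<close>

lemma SA_almost_action: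
  fixes S :: "'g::group_add set" and \<delta> :: real
  assumes \<phi>: "\<phi> \<in> SA (grp_elem ` S) 2 \<delta> d"
    and S: "finite S" "0 \<in> S" "\<And>g. g \<in> S \<Longrightarrow> - g \<in> S" and \<delta>: "0 < \<delta>" "\<delta> \<le> 1"
  obtains X where "almost_action S d (mat_rel d \<phi>) X"
    "real (card X) \<le> (1 + real (card S) + (real (card S))\<^sup>2) * \<delta> * d"
proof -
  note perm = SA_grp_elem(1)[OF \<phi>] and perm2 = SA_grp_elem(2)[OF \<phi>]
  note rows = partial_perm_matsD(4)[OF perm] and cols = partial_perm_matsD(3)[OF perm]
  define Fix where "Fix g = {j\<in>{..<d}. \<phi> (grp_elem g) $$ (j, j) = 1}" for g
  define D where "D = (\<lambda>(g, h). differing_cols d (\<phi> (grp_elem (g + h))) (\<phi> (grp_elem g) * \<phi> (grp_elem h)))"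
  define X where "X = ({..<d} - Fix 0) \<union> (\<Union>g\<in>S - {0}. Fix g) \<union> (\<Union>p\<in>S \<times> S. D p)"
  have tr: "cmod (of_real (real (card (Fix g)) / d) - (if g = 0 then 1 else 0)) < \<delta>" if "g \<in> S" for g
    using SA_grp_elem(4)[OF \<phi> that] unfolding ntr_partial_perm[OF perm[OF that]] Fix_def .
  have Fix0: "real (card ({..<d} - Fix 0)) \<le> \<delta> * d"
  proof -
    have "Fix 0 \<subseteq> {..<d}" by (auto simp: Fix_def)
    then have le: "card (Fix 0) \<le> d" and "card ({..<d} - Fix 0) = d - card (Fix 0)"
      using card_mono[of "{..<d}" "Fix 0"] by (auto simp: card_Diff_subset finite_subset)
    then have eq: "real (card ({..<d} - Fix 0)) = real d - real (card (Fix 0))" by simp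
    have "cmod (of_real (real (card (Fix 0)) / d - 1)) < \<delta>" using tr[OF S(2)] by simp
    then have "\<bar>real (card (Fix 0)) / d - 1\<bar> < \<delta>" by (simp only: norm_of_real)
    then have "1 - real (card (Fix 0)) / d < \<delta>" by argo
    then show ?thesis unfolding eq
      by (cases "d = 0") (auto simp: field_simps)
  qed
  have Fixg: "real (card (Fix g)) \<le> \<delta> * d" if "g \<in> S - {0}" for g
  proof -
    have "cmod (of_real (real (card (Fix g)) / d)) < \<delta>" using tr[of g] that by simp
    then have "\<bar>real (card (Fix g)) / d\<bar> < \<delta>" by (simp only: norm_of_real)
    then have "real (card (Fix g)) / d < \<delta>" by argo
    then show ?thesis by (cases "d = 0") (auto simp: field_simps Fix_def)
  qed
  have cD: "real (card (D p)) \<le> \<delta> * d" if p: "p \<in> S \<times> S" for p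
  proof -
    obtain g h where gh: "p = (g, h)" "g \<in> S" "h \<in> S" using p by auto
    have "real (card (D p)) \<le> \<delta>\<^sup>2 * d"
      unfolding gh(1) D_def prod.case
      by (rule card_differing_cols_le[OF perm2[OF gh(2,3)] partial_perm_mats_mult[OF perm perm] SA_grp_elem(3)[OF \<phi>]])
        (use gh in auto)
    also have "\<dots> \<le> \<delta> * d"
      using \<delta> by (intro mult_right_mono) (simp_all add: power2_eq_square mult_left_le)
    finally show ?thesis .
  qed
  have "card X \<le> card ({..<d} - Fix 0) + (\<Sum>g\<in>S - {0}. card (Fix g)) + (\<Sum>p\<in>S \<times> S. card (D p))"
  proof -
    have "card X \<le> card (({..<d} - Fix 0) \<union> (\<Union>g\<in>S - {0}. Fix g)) + card (\<Union>p\<in>S \<times> S. D p)"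
      unfolding X_def by (rule card_Un_le)
    moreover have "card (({..<d} - Fix 0) \<union> (\<Union>g\<in>S - {0}. Fix g))
        \<le> card ({..<d} - Fix 0) + card (\<Union>g\<in>S - {0}. Fix g)"
      by (rule card_Un_le)
    moreover have "card (\<Union>g\<in>S - {0}. Fix g) \<le> (\<Sum>g\<in>S - {0}. card (Fix g))"
      using S(1) by (intro card_UN_le) simp
    moreover have "card (\<Union>p\<in>S \<times> S. D p) \<le> (\<Sum>p\<in>S \<times> S. card (D p))"
      using S(1) by (intro card_UN_le) simp
    ultimately show ?thesis by linarith
  qed
  then have "real (card X) \<le> real (card ({..<d} - Fix 0)) + (\<Sum>g\<in>S - {0}. real (card (Fix g)))
      + (\<Sum>p\<in>S \<times> S. real (card (D p)))"
    by (simp flip: of_nat_sum of_nat_add)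
  also have "\<dots> \<le> \<delta> * d + (\<Sum>g\<in>S - {0}. \<delta> * d) + (\<Sum>p\<in>S \<times> S. \<delta> * d)"
    using Fix0 Fixg cD by (intro add_mono sum_mono) auto
  also have "\<dots> \<le> \<delta> * d + card S * (\<delta> * d) + (card S)\<^sup>2 * (\<delta> * d)"
  proof -
    have "real (card (S - {0})) * (\<delta> * d) \<le> real (card S) * (\<delta> * d)"
      using \<delta> S(1) by (intro mult_right_mono) (auto intro: card_mono)
    then show ?thesis by (simp add: card_cartesian_product power2_eq_square)
  qed
  also have "\<dots> = (1 + real (card S) + (real (card S))\<^sup>2) * \<delta> * d"
    by (simp add: algebra_simps)
  finally have cardX: "real (card X) \<le> (1 + real (card S) + (real (card S))\<^sup>2) * \<delta> * d" .
  have "almost_action S d (mat_rel d \<phi>) X"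
  proof
    show "mat_rel d \<phi> g i j \<Longrightarrow> i < d \<and> j < d" for g i j by (simp add: mat_rel_def)
    show "i = i'" if "g \<in> S" "mat_rel d \<phi> g i j" "mat_rel d \<phi> g i' j" for g i i' j
      using that cols[OF that(1), of i i' j] by (simp add: mat_rel_def)
    show "j = j'" if "g \<in> S" "mat_rel d \<phi> g i j" "mat_rel d \<phi> g i j'" for g i j j'
      using that rows[OF that(1), of i j j'] by (simp add: mat_rel_def)
    show "X \<subseteq> {..<d}" by (auto simp: X_def Fix_def D_def differing_cols_def)
    show "0 \<in> S" by (rule S(2))
    show "- g \<in> S" if "g \<in> S" for g using that by (rule S(3))
    show "mat_rel d \<phi> 0 j j" if "j < d" "j \<notin> X" for j
    proof -
      have "j \<in> Fix 0" using that by (simp add: X_def)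
      then show ?thesis by (simp add: mat_rel_def Fix_def)
    qed
    show "g = 0" if "j < d" "j \<notin> X" "g \<in> S" "mat_rel d \<phi> g j j" for g j
    proof (rule ccontr)
      assume "g \<noteq> 0"
      moreover have "j \<in> Fix g" using that by (simp add: mat_rel_def Fix_def)
      ultimately show False using that by (auto simp: X_def)
    qed
    show "mat_rel d \<phi> (g + h) i j \<longleftrightarrow> (\<exists>l. mat_rel d \<phi> g i l \<and> mat_rel d \<phi> h l j)"
      if j: "j < d" "j \<notin> X" and gh: "g \<in> S" "h \<in> S" for g h i j
    proof (cases "i < d")
      case True
      have "j \<notin> D (g, h)" using j gh by (auto simp: X_def)
      then have "\<phi> (grp_elem (g + h)) $$ (i, j) = (\<phi> (grp_elem g) * \<phi> (grp_elem h)) $$ (i, j)"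
        using True j(1) by (auto simp: D_def differing_cols_def)
      also have "\<dots> = (if \<exists>l<d. \<phi> (grp_elem g) $$ (i, l) = 1 \<and> \<phi> (grp_elem h) $$ (l, j) = 1 then 1 else 0)"
        by (rule partial_perm_mats_mult_index[OF perm[OF gh(1)] perm[OF gh(2)] True j(1)])
      finally show ?thesis using True j(1) by (auto simp: mat_rel_def)
    next
      case False
      then show ?thesis by (simp add: mat_rel_def)
    qed
  qed
  then show thesis using that cardX by blast
qed

text \<open>
  Counting by codes: the relation \<open>P c x\<close> says that \<open>c\<close> is a code of \<open>x\<close>.
\<close>

lemma card_image_le_of_codes:
  assumes C: "finite C" and code: "\<And>x. x \<in> A \<Longrightarrow> \<exists>c\<in>C. P c x"
    and inj: "\<And>c x y. x \<in> A \<Longrightarrow> y \<in> A \<Longrightarrow> P c x \<Longrightarrow> P c y \<Longrightarrow> f x = f y"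
  shows "finite (f ` A)" "card (f ` A) \<le> card C"
proof -
  define h where "h c = f (SOME x. x \<in> A \<and> P c x)" for c
  have sub: "f ` A \<subseteq> h ` C"
  proof (rule image_subsetI)
    fix x assume x: "x \<in> A"
    obtain c where c: "c \<in> C" "P c x" using code[OF x] by blast
    have "(SOME x. x \<in> A \<and> P c x) \<in> A \<and> P c (SOME x. x \<in> A \<and> P c x)"
      by (rule someI[of "\<lambda>x. x \<in> A \<and> P c x" x]) (use x c in blast)
    then have "f x = h c" unfolding h_def using inj[OF x _ c(2)] by blast
    then show "f x \<in> h ` C" using c(1) by blast
  qed
  show "finite (f ` A)" using finite_subset[OF sub finite_imageI[OF C]] .
  have "card (f ` A) \<le> card (h ` C)" using sub C by (intro card_mono) auto
  also have "\<dots> \<le> card C" using C by (rule card_image_le)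
  finally show "card (f ` A) \<le> card C" .
qed

lemma SA_restrict_eqI:
  fixes S :: "'g::group_add set"
  assumes \<phi>: "\<phi> \<in> SA (grp_elem ` S) 2 \<delta> d" and \<psi>: "\<psi> \<in> SA (grp_elem ` S) 2 \<delta> d"
    and E: "E \<subseteq> I_G" and ES: "\<And>s. grp_elem s \<in> E \<Longrightarrow> s \<in> S"
    and eq: "\<And>s i j. grp_elem s \<in> E \<Longrightarrow> mat_rel d \<phi> s i j \<longleftrightarrow> mat_rel d \<psi> s i j"
  shows "restrict \<phi> E = restrict \<psi> E"
proof (rule restrict_ext)
  fix x assume x: "x \<in> E"
  have zero: "\<chi> 0 = 0\<^sub>m d d" if "\<chi> \<in> SA (grp_elem ` S) 2 \<delta> d" for \<chi> :: "'g group_algebra \<Rightarrow> complex mat"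
  proof -
    have lin: "linear_to_mat d \<chi>" using that by (simp add: SA_def)
    then have C: "\<chi> 0 \<in> carrier_mat d d" and "\<chi> (0 + 0) = \<chi> 0 + \<chi> 0"
      unfolding linear_to_mat_def by blast+
    then have add: "\<chi> 0 = \<chi> 0 + \<chi> 0" by simp
    show ?thesis
    proof (rule eq_matI)
      fix i j assume ij: "i < dim_row (0\<^sub>m d d :: complex mat)" "j < dim_col (0\<^sub>m d d :: complex mat)"
      then have "\<chi> 0 $$ (i, j) = \<chi> 0 $$ (i, j) + \<chi> 0 $$ (i, j)"
        using C add by (metis carrier_matD index_add_mat(1) index_zero_mat(2,3))
      then show "\<chi> 0 $$ (i, j) = 0\<^sub>m d d $$ (i, j)" using ij by simp
    qed (use C in auto)
  qed
  show "\<phi> x = \<psi> x"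
  proof (cases "x = 0")
    case True
    then show ?thesis using zero[OF \<phi>] zero[OF \<psi>] by simp
  next
    case False
    then obtain s where s: "x = grp_elem s" using x E by (auto simp: I_G_def)
    have sS: "s \<in> S" using ES x s by blast
    note P = partial_perm_matsD[OF SA_grp_elem(1)[OF \<phi> sS]] and Q = partial_perm_matsD[OF SA_grp_elem(1)[OF \<psi> sS]]
    show ?thesis
    proof (rule eq_matI)
      fix i j assume "i < dim_row (\<psi> x)" "j < dim_col (\<psi> x)"
      then have ij: "i < d" "j < d" using Q(1) s by auto
      have "\<phi> (grp_elem s) $$ (i, j) = 1 \<longleftrightarrow> \<psi> (grp_elem s) $$ (i, j) = 1"
        using eq[of s i j] x s ij by (simp add: mat_rel_def)
      then show "\<phi> x $$ (i, j) = \<psi> x $$ (i, j)" using P(2)[OF ij] Q(2)[OF ij] s by auto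
    qed (use P(1) Q(1) s in auto)
  qed
qed

section \<open>The upper bound\<close>

text \<open>
  The sums of four elements of \<open>K\<close>, \<open>E\<close>, their inverses and \<open>0\<close> form a set that meets all
  requirements of the locale \<open>folner_action\<close>.
\<close>

lemma enveloping_set:
  fixes K E :: "'g::group_add set"
  assumes K: "finite K" and E: "finite E"
  obtains S where "finite S" "0 \<in> S" "\<And>g. g \<in> S \<Longrightarrow> - g \<in> S" "E \<subseteq> S"
    "\<And>k s. k \<in> K \<Longrightarrow> s \<in> insert 0 E \<Longrightarrow> - k + s \<in> S"
    "\<And>k s k' s'. k \<in> K \<Longrightarrow> s \<in> insert 0 E \<Longrightarrow> k' \<in> K \<Longrightarrow> s' \<in> insert 0 E
      \<Longrightarrow> - (- k' + s') + (- k + s) \<in> S"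
proof -
  \<comment> \<open>Four summands, because \<open>- (- k' + s') + (- k + s)\<close> is \<open>- s' + k' + - k + s\<close>; having \<open>0\<close> in \<open>B\<close>
    allows fewer.\<close>
  define B where "B = insert 0 (K \<union> E \<union> uminus ` (K \<union> E))"
  define S where "S = (\<lambda>(a, b, c, e). a + b + c + e) ` (B \<times> B \<times> B \<times> B)"
  have B: "finite B" "0 \<in> B" "\<And>b. b \<in> B \<Longrightarrow> - b \<in> B" using K E by (auto simp: B_def)
  have BK: "k \<in> B" "- k \<in> B" if "k \<in> K" for k using that by (auto simp: B_def)
  have BE: "s \<in> B" "- s \<in> B" if "s \<in> insert 0 E" for s using that by (auto simp: B_def)
  have SI: "a + b + c + e \<in> S" if "a \<in> B" "b \<in> B" "c \<in> B" "e \<in> B" for a b c e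
    unfolding S_def using that by (intro image_eqI[of _ _ "(a, b, c, e)"]) auto
  show thesis
  proof (rule that[of S])
    show "finite S" using B by (simp add: S_def)
    show "0 \<in> S" using SI[OF B(2) B(2) B(2) B(2)] by simp
    show "- g \<in> S" if "g \<in> S" for g
    proof -
      obtain a b c e where g: "g = a + b + c + e" "a \<in> B" "b \<in> B" "c \<in> B" "e \<in> B"
        using \<open>g \<in> S\<close> by (auto simp: S_def)
      have "- g = - e + - c + - b + - a" unfolding g(1) by (simp only: minus_add add.assoc)
      then show ?thesis using SI[OF B(3)[OF g(5)] B(3)[OF g(4)] B(3)[OF g(3)] B(3)[OF g(2)]] by simp
    qed
    show "E \<subseteq> S" using SI[OF BE(1) B(2) B(2) B(2)] by auto
    show "- k + s \<in> S" if "k \<in> K" "s \<in> insert 0 E" for k s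
      using SI[OF BK(2)[OF that(1)] BE(1)[OF that(2)] B(2) B(2)] by simp
    show "- (- k' + s') + (- k + s) \<in> S"
      if "k \<in> K" "s \<in> insert 0 E" "k' \<in> K" "s' \<in> insert 0 E" for k s k' s'
    proof -
      have "- (- k' + s') + (- k + s) = - s' + k' + - k + s"
        by (simp only: minus_add minus_minus add.assoc)
      then show ?thesis
        using SI[OF BE(2)[OF that(4)] BK(1)[OF that(3)] BK(2)[OF that(1)] BE(1)[OF that(2)]] by simp
    qed
  qed
qed

text \<open>
  The number of restrictions to \<open>E\<close> is at most that of codes with \<open>\<mu> * d\<close> deviations. The factor
  \<open>1 + card S + (card S)\<^sup>2\<close> in \<open>\<mu>\<close> counts the conditions on a point that define the exceptional set.
\<close>

lemma sofic_rate_le: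
  fixes E :: "'g::group_add group_algebra set" and S K E0 :: "'g set" and \<delta> \<epsilon> \<mu> :: real
  assumes E: "finite E" "E \<subseteq> I_G"
    and E0: "E0 = grp_elem -` E"
    and K: "finite K" "0 \<in> K"
    and folner: "\<And>s. s \<in> E0 \<Longrightarrow> card {k\<in>K. s + k \<notin> K} \<le> \<epsilon> * card K" and \<epsilon>: "0 \<le> \<epsilon>"
    and S: "finite S" "0 \<in> S" "\<And>g. g \<in> S \<Longrightarrow> - g \<in> S" "E0 \<subseteq> S"
      "\<And>k s. k \<in> K \<Longrightarrow> s \<in> insert 0 E0 \<Longrightarrow> - k + s \<in> S"
      "\<And>k s k' s'. k \<in> K \<Longrightarrow> s \<in> insert 0 E0 \<Longrightarrow> k' \<in> K \<Longrightarrow> s' \<in> insert 0 E0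
        \<Longrightarrow> - (- k' + s') + (- k + s) \<in> S"
    and \<delta>: "0 < \<delta>" "\<delta> \<le> 1"
    and \<mu>: "1 - 1 / card K + card E0 * (2 * ((1 + real (card S) + (real (card S))\<^sup>2) * \<delta>) + 2 * \<epsilon>) \<le> \<mu>"
    and d: "d > 1"
  shows "sofic_rate E (grp_elem ` S) 2 \<delta> d \<le>
    ereal (((card E0 + 1) * ln 2 * d + \<mu> * d * ln (real d + 2) + ln (real (card K) + 1) * d) / (real d * ln d))"
proof -
  have E0fin: "finite E0" unfolding E0 using E(1) inj_grp_elem by (rule finite_vimageI)
  let ?A = "SA (grp_elem ` S) 2 \<delta> d :: ('g group_algebra \<Rightarrow> complex mat) set"
  let ?C = "code_set d E0 K (\<mu> * d)"
  let ?P = "\<lambda>c \<phi>. \<forall>s\<in>E0. \<forall>i j. mat_rel d \<phi> s i j \<longleftrightarrow> decode d (fst c) (snd c) s i j"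
  let ?f = "\<lambda>\<phi> :: 'g group_algebra \<Rightarrow> complex mat. restrict \<phi> E"
  have C: "finite ?C" "real (card ?C) \<le> 2 ^ ((card E0 + 1) * d) * (real d + 2) powr (\<mu> * d) * (real (card K) + 1) ^ d"
    using card_code_set[OF E0fin K(1)] by blast+
  have code: "\<exists>c\<in>?C. ?P c \<phi>" if \<phi>: "\<phi> \<in> ?A" for \<phi>
  proof -
    obtain X where action: "almost_action S d (mat_rel d \<phi>) X"
      and cardX: "real (card X) \<le> (1 + real (card S) + (real (card S))\<^sup>2) * \<delta> * d"
      using SA_almost_action[OF \<phi> S(1-3) \<delta>] by blast
    interpret almost_action S d "mat_rel d \<phi>" X by (rule action)
    interpret folner_action S d "mat_rel d \<phi>" X K E0 \<epsilon>
      by unfold_locales (fact K E0fin S folner \<epsilon>)+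
    have "cost_bound \<le> \<mu> * d"
    proof -
      have "real (card E0) * (2 * real (card X) + 2 * \<epsilon> * d)
          \<le> real (card E0) * (2 * ((1 + real (card S) + (real (card S))\<^sup>2) * \<delta> * d) + 2 * \<epsilon> * d)"
        by (rule mult_left_mono[OF add_right_mono[OF mult_left_mono[OF cardX]]]) simp_all
      then have "cost_bound \<le> (1 - 1 / card K
          + card E0 * (2 * ((1 + real (card S) + (real (card S))\<^sup>2) * \<delta>) + 2 * \<epsilon>)) * d"
        unfolding cost_bound_def by (simp add: algebra_simps)
      also have "\<dots> \<le> \<mu> * d" using \<mu> by (rule mult_right_mono) simp
      finally show ?thesis .
    qed
    then have sub: "code_set d E0 K cost_bound \<subseteq> ?C" by (rule code_set_mono)
    obtain w a where "(w, a) \<in> code_set d E0 K cost_bound"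
      "\<And>s i j. s \<in> E0 \<Longrightarrow> mat_rel d \<phi> s i j \<longleftrightarrow> decode d w a s i j"
      by (rule encode) (rule that; assumption)
    then show ?thesis using sub by (intro bexI[of _ "(w, a)"]) (simp, blast)
  qed
  have inj: "?f \<phi> = ?f \<psi>" if \<phi>: "\<phi> \<in> ?A" and \<psi>: "\<psi> \<in> ?A" and c: "?P c \<phi>" "?P c \<psi>" for c \<phi> \<psi>
  proof (rule SA_restrict_eqI[OF \<phi> \<psi> E(2)])
    show "s \<in> S" if s: "grp_elem s \<in> E" for s using s S(4) by (auto simp: E0)
    show "mat_rel d \<phi> s i j \<longleftrightarrow> mat_rel d \<psi> s i j" if s: "grp_elem s \<in> E" for s i j
    proof -
      have "s \<in> E0" using s by (simp add: E0)
      then show ?thesis using c by simp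
    qed
  qed
  have fin: "finite (?f ` ?A)" and card: "card (?f ` ?A) \<le> card ?C"
    by (rule card_image_le_of_codes[of ?C ?A ?P ?f, OF C(1) code inj]; assumption)+
  have lnd: "real d * ln (real d) > 0" using d by simp
  show ?thesis
  proof (cases "?f ` ?A = {}")
    case True
    then have "sofic_rate E (grp_elem ` S) 2 \<delta> d = - \<infinity>"
      using lnd unfolding sofic_rate_def True log_card_def by simp
    then show ?thesis by simp
  next
    case False
    define N where "N = card (?f ` ?A)"
    have N: "N > 0" unfolding N_def by (rule card_gt_0_iff[THEN iffD2, OF conjI[OF False fin]])
    define B where "B = 2 ^ ((card E0 + 1) * d) * (real d + 2) powr (\<mu> * d) * (real (card K) + 1) ^ d"
    have "real N \<le> real (card ?C)" unfolding N_def using card by (rule of_nat_mono)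
    then have "real N \<le> B" using C(2) unfolding B_def by (rule order_trans)
    moreover have "B > 0" unfolding B_def by (intro mult_pos_pos) (simp_all add: add_pos_nonneg)
    ultimately have "ln (real N) \<le> ln B" using N by simp
    also have "ln B = ln (2 ^ ((card E0 + 1) * d) * (real d + 2) powr (\<mu> * d) * (real (card K) + 1) ^ d)"
      by (simp only: B_def)
    also have "\<dots> = (card E0 + 1) * ln 2 * d + \<mu> * d * ln (real d + 2) + ln (real (card K) + 1) * d"
      by (simp add: ln_mult ln_realpow ln_powr algebra_simps)
    finally have "ln (real N) / (real d * ln d) \<le>
        ((card E0 + 1) * ln 2 * d + \<mu> * d * ln (real d + 2) + ln (real (card K) + 1) * d) / (real d * ln d)"
      using lnd by (intro divide_right_mono) auto
    moreover have "sofic_rate E (grp_elem ` S) 2 \<delta> d = ereal (ln (real N) / (real d * ln d))"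
    proof -
      have "log_card (?f ` ?A) = ereal (ln (real N))" using fin False unfolding log_card_def N_def by (simp only: not_True_eq_False if_False simp_thms)
      then show ?thesis unfolding sofic_rate_def using d by simp
    qed
    ultimately show ?thesis by simp
  qed
qed

text \<open>
  The Folner parameter \<open>\<epsilon>\<close> is chosen first, then \<open>K\<close>, then \<open>S\<close>, and \<open>\<delta>\<close> last, since the number of
  exceptional points depends on \<open>S\<close>. In a finite group \<open>card K\<close> is at most the order of the group; in
  an infinite group the term \<open>- 1 / card K\<close> is simply dropped.
\<close>

lemma amenable_s_rel_le:
  fixes E :: "'g::group_add group_algebra set" and \<eta> :: real
  assumes am: "amenable TYPE('g)" and E: "finite E" "E \<subseteq> I_G" and \<eta>: "\<eta> > 0"
  obtains F where "finite F" "F \<subseteq> I_G" "s_rel E F \<le> ereal (1 - inverse (real (card (UNIV :: 'g set))) + \<eta>)"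
proof -
  define E0 :: "'g set" where "E0 = grp_elem -` E"
  have E0: "finite E0" unfolding E0_def using E(1) inj_grp_elem by (rule finite_vimageI)
  \<comment> \<open>Clusters cut by a move and exceptional points contribute at most \<open>2 * \<epsilon>\<close> each to \<open>\<mu>\<close>, for every
    element of \<open>E0\<close>.\<close>
  define \<epsilon> where "\<epsilon> = \<eta> / (4 * (real (card E0) + 1))"
  have \<epsilon>: "\<epsilon> > 0" unfolding \<epsilon>_def using \<eta> by simp
  obtain K where K: "finite K" "0 \<in> K" and folner: "\<And>s. s \<in> E0 \<Longrightarrow> card {k\<in>K. s + k \<notin> K} \<le> \<epsilon> * card K"
    using amenable_almost_invariant[OF am E0 \<epsilon>] by blast
  obtain S where S: "finite S" "0 \<in> S" "\<And>g. g \<in> S \<Longrightarrow> - g \<in> S" "E0 \<subseteq> S"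
    "\<And>k s. k \<in> K \<Longrightarrow> s \<in> insert 0 E0 \<Longrightarrow> - k + s \<in> S"
    "\<And>k s k' s'. k \<in> K \<Longrightarrow> s \<in> insert 0 E0 \<Longrightarrow> k' \<in> K \<Longrightarrow> s' \<in> insert 0 E0
      \<Longrightarrow> - (- k' + s') + (- k + s) \<in> S"
    using enveloping_set[OF K(1) E0] by blast
  define C where "C = 1 + real (card S) + (real (card S))\<^sup>2"
  have C: "C > 0" unfolding C_def by (simp add: add_pos_nonneg)
  define \<delta> where "\<delta> = min 1 (\<epsilon> / C)"
  have \<delta>: "0 < \<delta>" "\<delta> \<le> 1" using \<epsilon> C by (auto simp: \<delta>_def)
  define \<mu> where "\<mu> = 1 - inverse (real (card (UNIV :: 'g set))) + \<eta>"
  have Kpos: "card K > 0" using K by (auto simp: card_gt_0_iff)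
  have \<mu>: "1 - 1 / card K + card E0 * (2 * ((1 + real (card S) + (real (card S))\<^sup>2) * \<delta>) + 2 * \<epsilon>) \<le> \<mu>"
  proof -
    have "C * \<delta> \<le> C * (\<epsilon> / C)" using C by (intro mult_left_mono) (auto simp: \<delta>_def)
    then have "C * \<delta> \<le> \<epsilon>" using C by simp
    then have "card E0 * (2 * (C * \<delta>) + 2 * \<epsilon>) \<le> card E0 * (4 * \<epsilon>)"
      by (intro mult_left_mono) auto
    also have "\<dots> \<le> (real (card E0) + 1) * (4 * \<epsilon>)" using \<epsilon> by (intro mult_right_mono) auto
    also have "\<dots> = \<eta>"
    proof -
      have "r * (4 * (\<eta> / (4 * r))) = \<eta>" if "r > 0" for r :: real using that by simp
      from this[of "real (card E0) + 1"] show ?thesis unfolding \<epsilon>_def by simp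
    qed
    finally have "card E0 * (2 * (C * \<delta>) + 2 * \<epsilon>) \<le> \<eta>" .
    moreover have "inverse (real (card (UNIV :: 'g set))) \<le> 1 / card K"
    proof (cases "finite (UNIV :: 'g set)")
      case True
      then have "card K \<le> card (UNIV :: 'g set)" by (intro card_mono) auto
      then show ?thesis using Kpos by (simp add: inverse_eq_divide frac_le)
    next
      case False
      then show ?thesis by simp
    qed
    ultimately show ?thesis unfolding \<mu>_def C_def by argo
  qed
  let ?h = "\<lambda>d. ((card E0 + 1) * ln 2 * d + \<mu> * d * ln (real d + 2) + ln (real (card K) + 1) * d) / (real d * ln d)"
  have "s_rel E (grp_elem ` S) \<le> limsup (sofic_rate E (grp_elem ` S) 2 \<delta>)"
    unfolding s_rel_def
    by (rule INF_lower2[of 2], simp, rule INF_lower2[of \<delta>]) (use \<delta> in auto)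
  also have "\<dots> \<le> limsup (\<lambda>d. ereal (?h d))"
  proof (rule Limsup_mono)
    have "\<forall>\<^sub>F d :: nat in sequentially. d > 1" by (rule eventually_gt_at_top)
    then show "\<forall>\<^sub>F d in sequentially. sofic_rate E (grp_elem ` S) 2 \<delta> d \<le> ereal (?h d)"
    proof eventually_elim
      case (elim d)
      show ?case
        by (rule sofic_rate_le[OF E E0_def K folner less_imp_le[OF \<epsilon>] S \<delta> \<mu> elim])
    qed
  qed
  also have "\<dots> = ereal \<mu>"
  proof -
    have "?h \<longlonglongrightarrow> \<mu>" by real_asymp
    then have "(\<lambda>d. ereal (?h d)) \<longlonglongrightarrow> ereal \<mu>" by simp
    then show ?thesis by (intro lim_imp_Limsup) simp_all
  qed
  finally have "s_rel E (grp_elem ` S) \<le> ereal \<mu>" .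
  then show thesis using that[of "grp_elem ` S"] S(1) by (auto simp: \<mu>_def I_G_def)
qed

section \<open>The sofic dimension\<close>

lemma sofic_dim_le:
  assumes am: "amenable TYPE('g::group_add)"
  shows "sofic_dim TYPE('g) \<le> ereal (1 - inverse (real (card (UNIV :: 'g set))))"
  unfolding sofic_dim_def
proof (rule SUP_least)
  fix E :: "'g group_algebra set"
  assume E: "E \<in> {E. finite E \<and> E \<subseteq> I_G}"
  show "(INF F\<in>{F. finite F \<and> F \<subseteq> I_G}. s_rel E F) \<le> ereal (1 - inverse (real (card (UNIV :: 'g set))))"
  proof (rule ereal_le_epsilon2)
    fix \<eta> :: real assume \<eta>: "\<eta> > 0"
    have E': "finite E" "E \<subseteq> I_G" using E by simp_all
    obtain F where F: "finite F" "F \<subseteq> I_G"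
      "s_rel E F \<le> ereal (1 - inverse (real (card (UNIV :: 'g set))) + \<eta>)"
      by (rule amenable_s_rel_le[OF am E' \<eta>]) (rule that; assumption)
    then show "(INF F\<in>{F. finite F \<and> F \<subseteq> I_G}. s_rel E F)
        \<le> ereal (1 - inverse (real (card (UNIV :: 'g set)))) + ereal \<eta>"
      by (intro INF_lower2[of F]) auto
  qed
qed

lemma lower_sofic_dim_ge_card:
  fixes E :: "'g::group_add set"
  assumes am: "amenable TYPE('g)" and E: "finite E" "E \<noteq> {}"
  shows "ereal (1 - 1 / card E) \<le> lower_sofic_dim TYPE('g)"
proof -
  have "ereal (1 - 1 / card E) \<le> lower_s_rel (grp_elem ` E) F" if F: "finite F" "F \<subseteq> I_G" for F
    unfolding lower_s_rel_def
  proof (intro INF_greatest)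
    fix n :: nat and \<delta> :: real assume "\<delta> \<in> {0<..}"
    then have \<delta>: "\<delta> > 0" by simp
    show "ereal (1 - 1 / card E) \<le> liminf (sofic_rate (grp_elem ` E) F n \<delta>)"
    proof (rule ereal_le_epsilon2)
      fix \<eta> :: real assume \<eta>: "\<eta> > 0"
      have "ereal (1 - 1 / card E - \<eta>) + ereal \<eta> \<le> liminf (sofic_rate (grp_elem ` E) F n \<delta>) + ereal \<eta>"
        by (rule add_right_mono[OF amenable_liminf_sofic_rate[OF am E F \<delta> \<eta>]])
      then show "ereal (1 - 1 / card E) \<le> liminf (sofic_rate (grp_elem ` E) F n \<delta>) + ereal \<eta>"
        by simp
    qed
  qed
  then show ?thesis
    unfolding lower_sofic_dim_def
    using E by (intro SUP_upper2[of "grp_elem ` E"] INF_greatest) (auto simp: I_G_def)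
qed

lemma lower_sofic_dim_ge:
  assumes am: "amenable TYPE('g::group_add)"
  shows "ereal (1 - inverse (real (card (UNIV :: 'g set)))) \<le> lower_sofic_dim TYPE('g)"
proof (cases "finite (UNIV :: 'g set)")
  case True
  then show ?thesis using lower_sofic_dim_ge_card[OF am, of UNIV] by (simp add: inverse_eq_divide)
next
  case False
  have "ereal 1 \<le> lower_sofic_dim TYPE('g)"
  proof (rule ereal_le_epsilon2)
    fix \<eta> :: real assume "\<eta> > 0"
    then obtain n :: nat where n: "n > 0" "inverse n < \<eta>" using ex_inverse_of_nat_less by blast
    obtain E :: "'g set" where E: "finite E" "card E = n"
      using infinite_arbitrarily_large[OF False] by blast
    have "E \<noteq> {}" using E n by auto
    then have "ereal (1 - 1 / card E) \<le> lower_sofic_dim TYPE('g)"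
      by (rule lower_sofic_dim_ge_card[OF am E(1)])
    then have "ereal (1 - 1 / n) + ereal \<eta> \<le> lower_sofic_dim TYPE('g) + ereal \<eta>"
      unfolding E(2) by (rule add_right_mono)
    moreover have "ereal 1 \<le> ereal (1 - 1 / n) + ereal \<eta>"
      using n by (simp add: inverse_eq_divide)
    ultimately show "ereal 1 \<le> lower_sofic_dim TYPE('g) + ereal \<eta>" by (rule order_trans[rotated])
  qed
  then show ?thesis using False by simp
qed

lemma lower_sofic_dim_le_sofic_dim: "lower_sofic_dim TYPE('g::group_add) \<le> sofic_dim TYPE('g)"
proof -
  have "lower_s_rel E F \<le> s_rel E F" for E F :: "'g group_algebra set"
    unfolding lower_s_rel_def s_rel_def by (intro INF_mono' Liminf_le_Limsup) simp
  then show ?thesis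
    unfolding lower_sofic_dim_def sofic_dim_def by (intro SUP_mono' INF_mono')
qed

theorem theorem4p12:
  assumes "amenable TYPE('g::{group_add,countable})"
  shows "sofic_dim TYPE('g) = lower_sofic_dim TYPE('g) \<and>
         lower_sofic_dim TYPE('g) = ereal (1 - inverse (real (card (UNIV :: 'g set))))"
  using sofic_dim_le[OF assms] lower_sofic_dim_ge[OF assms] lower_sofic_dim_le_sofic_dim[where 'g = 'g]
  by (meson order_antisym order_trans)

end
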